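(* The coefficients of the magnitude of a real central hyperplane arrangement need not eventually alternate: there exists a real central hyperplane arrangement $\mathcal A$ for which it is not the case that $(-1)^\ell[q^\ell]\operatorname{Mag}(\mathcal A;q)\ge0$ for all sufficiently large $\ell$. In particular, the conjecture (of Koizumi--Liu) that for every real central hyperplane arrangement $\mathcal A$ one has $(-1)^\ell[q^\ell]\operatorname{Mag}(\mathcal A;q)\ge0$ for all sufficiently large $\ell$ is false.
   Context: A real central hyperplane arrangement $\mathcal A$ is a finite set of linear hyperplanes in some $\mathbb R^n$. Its chambers are the connected components of the complement of the union of the hyperplanes; its tope graph $G$ has the chambers as vertices, two chambers being adjacent when separated by exactly one hyperplane, and the distance $d(B,C)$ is the number of hyperplanes separating $B$ and $C$. The magnitude is $\operatorname{Mag}(\mathcal A;q)=\mathbf 1^{\mathsf T}K(q)^{-1}\mathbf 1$, where $K(q)=(q^{d(B,C)})_{B,C}$; it is a rational function regular at $q=0$, and $[q^\ell]$ denotes the coefficient in its Taylor expansion at $0$. *)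

theory Defs
  imports
    "HOL-Analysis.Analysis"
    "HOL-Computational_Algebra.Computational_Algebra"
begin

section \<open>Real central hyperplane arrangements\<close>

text \<open>
  The dimension has to be a bound variable, so $\mathbb{R}^n$ is the library's topological space
  \<^term>\<open>Euclidean_space n\<close>, whose points are the functions \<open>x :: nat \<Rightarrow> real\<close> with \<open>x i = 0\<close>
  for all \<open>i \<ge> n\<close>.
\<close>

definition linear_form :: "nat \<Rightarrow> (nat \<Rightarrow> real) \<Rightarrow> (nat \<Rightarrow> real) \<Rightarrow> real" where
  "linear_form n a x = (\<Sum>i<n. a i * x i)"

definition hyperplane :: "nat \<Rightarrow> (nat \<Rightarrow> real) \<Rightarrow> (nat \<Rightarrow> real) set" where
  "hyperplane n a = {x \<in> topspace (Euclidean_space n). linear_form n a x = 0}"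

definition central_arrangement :: "nat \<Rightarrow> (nat \<Rightarrow> real) set set \<Rightarrow> bool" where
  "central_arrangement n \<A> \<longleftrightarrow>
     finite \<A> \<and> (\<forall>H\<in>\<A>. \<exists>a. (\<exists>i<n. a i \<noteq> 0) \<and> H = hyperplane n a)"

definition chambers :: "nat \<Rightarrow> (nat \<Rightarrow> real) set set \<Rightarrow> (nat \<Rightarrow> real) set set" where
  "chambers n \<A> =
     connected_components_of
       (subtopology (Euclidean_space n) (topspace (Euclidean_space n) - \<Union>\<A>))"

text \<open>
  The normal vector \<open>a\<close> may be replaced by \<open>- a\<close>, so the relation is symmetric in \<open>B\<close> and \<open>C\<close>.
\<close>

definition separates ::
  "nat \<Rightarrow> (nat \<Rightarrow> real) set \<Rightarrow> (nat \<Rightarrow> real) set \<Rightarrow> (nat \<Rightarrow> real) set \<Rightarrow> bool" where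
  "separates n H B C \<longleftrightarrow>
     (\<exists>a. H = hyperplane n a \<and> (\<forall>x\<in>B. linear_form n a x > 0) \<and> (\<forall>x\<in>C. linear_form n a x < 0))"

definition chamber_dist ::
  "nat \<Rightarrow> (nat \<Rightarrow> real) set set \<Rightarrow> (nat \<Rightarrow> real) set \<Rightarrow> (nat \<Rightarrow> real) set \<Rightarrow> nat" where
  "chamber_dist n \<A> B C = card {H \<in> \<A>. separates n H B C}"


section \<open>Square matrices indexed by a finite set\<close>

definition is_inverse_on ::
  "'b set \<Rightarrow> ('b \<Rightarrow> 'b \<Rightarrow> 'a::semiring_1) \<Rightarrow> ('b \<Rightarrow> 'b \<Rightarrow> 'a) \<Rightarrow> bool" where
  "is_inverse_on S K L \<longleftrightarrow>
     (\<forall>B\<in>S. \<forall>C\<in>S. (\<Sum>D\<in>S. K B D * L D C) = (if B = C then 1 else 0) \<and>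
                   (\<Sum>D\<in>S. L B D * K D C) = (if B = C then 1 else 0))"

text \<open>
  Only the entries with both indices in \<open>S\<close> are meaningful; they are unique by
  \<open>is_inverse_on_unique\<close> below.
\<close>

definition inverse_on ::
  "'b set \<Rightarrow> ('b \<Rightarrow> 'b \<Rightarrow> 'a::semiring_1) \<Rightarrow> 'b \<Rightarrow> 'b \<Rightarrow> 'a" where
  "inverse_on S K = (SOME L. is_inverse_on S K L)"

lemma is_inverse_on_unique:
  fixes K :: "'b \<Rightarrow> 'b \<Rightarrow> 'a::semiring_1"
  assumes "finite S" "is_inverse_on S K L" "is_inverse_on S K M" "B \<in> S" "C \<in> S"
  shows "L B C = M B C"
proof -
  have "L B C = (\<Sum>D\<in>S. L B D * (if D = C then 1 else 0))"
    using assms by (simp add: if_distrib sum.delta cong: if_cong)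
  also have "\<dots> = (\<Sum>D\<in>S. L B D * (\<Sum>E\<in>S. K D E * M E C))"
    using assms by (intro sum.cong) (auto simp: is_inverse_on_def)
  also have "\<dots> = (\<Sum>D\<in>S. \<Sum>E\<in>S. L B D * K D E * M E C)"
    by (simp add: sum_distrib_left mult.assoc)
  also have "\<dots> = (\<Sum>E\<in>S. \<Sum>D\<in>S. L B D * K D E * M E C)"
    by (rule sum.swap)
  also have "\<dots> = (\<Sum>E\<in>S. (\<Sum>D\<in>S. L B D * K D E) * M E C)"
    by (simp add: sum_distrib_right)
  also have "\<dots> = (\<Sum>E\<in>S. (if B = E then 1 else 0) * M E C)"
    using assms by (intro sum.cong) (auto simp: is_inverse_on_def)
  also have "\<dots> = (\<Sum>E\<in>S. if B = E then M E C else 0)"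
    by (intro sum.cong) auto
  also have "\<dots> = M B C"
    using assms by (simp add: sum.delta')
  finally show ?thesis .
qed

lemma inverse_on_eq:
  assumes "finite S" "is_inverse_on S K L" "B \<in> S" "C \<in> S"
  shows "inverse_on S K B C = L B C"
  using is_inverse_on_unique[OF assms(1) _ assms(2-4)] someI[of "is_inverse_on S K", OF assms(2)]
  unfolding inverse_on_def by blast


section \<open>Magnitude\<close>

text \<open>The field of rational functions in \<open>q\<close> is \<^typ>\<open>real poly fract\<close>.\<close>

definition q_var :: "real poly fract" where
  "q_var = to_fract [:0, 1:]"

definition K_matrix ::
  "nat \<Rightarrow> (nat \<Rightarrow> real) set set \<Rightarrow> (nat \<Rightarrow> real) set \<Rightarrow> (nat \<Rightarrow> real) set \<Rightarrow> real poly fract" where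
  "K_matrix n \<A> B C = q_var ^ chamber_dist n \<A> B C"

definition magnitude :: "nat \<Rightarrow> (nat \<Rightarrow> real) set set \<Rightarrow> real poly fract" where
  "magnitude n \<A> =
     (\<Sum>B\<in>chambers n \<A>. \<Sum>C\<in>chambers n \<A>. inverse_on (chambers n \<A>) (K_matrix n \<A>) B C)"

text \<open>
  A rational function is regular at 0 iff it can be written as \<open>a / b\<close> with polynomials such that
  \<open>b(0) \<noteq> 0\<close>; then \<open>b\<close> is a unit in the ring of power series.  The value is independent of the
  representation by \<open>taylor_at_0_Fract\<close>, and unspecified if there is a pole at 0.
\<close>

definition taylor_at_0 :: "real poly fract \<Rightarrow> real fps" where
  "taylor_at_0 r =
     (THE f. \<exists>a b. poly b 0 \<noteq> 0 \<and> r = Fract a b \<and> f = fps_of_poly a / fps_of_poly b)"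

lemma taylor_at_0_Fract:
  fixes a b :: "real poly"
  assumes b: "poly b 0 \<noteq> 0"
  shows "taylor_at_0 (Fract a b) = fps_of_poly a / fps_of_poly b"
proof -
  have "fps_of_poly c / fps_of_poly d = fps_of_poly a / fps_of_poly b"
    if d: "poly d 0 \<noteq> 0" and eq: "Fract a b = Fract c d" for c d :: "real poly"
  proof -
    have "d \<noteq> 0" "b \<noteq> 0"
      using b d by auto
    hence "a * d = c * b"
      using eq by (simp add: eq_fract)
    hence *: "fps_of_poly a * fps_of_poly d = fps_of_poly c * fps_of_poly b"
      by (metis fps_of_poly_mult)
    have nz: "fps_nth (fps_of_poly b) 0 \<noteq> 0" "fps_nth (fps_of_poly d) 0 \<noteq> 0"
      using b d by (simp_all add: poly_0_coeff_0)
    have "fps_of_poly c * inverse (fps_of_poly d) =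
          fps_of_poly c * fps_of_poly b * inverse (fps_of_poly b) * inverse (fps_of_poly d)"
      using inverse_mult_eq_1'[OF nz(1)] by (simp add: mult.assoc)
    also have "\<dots> = fps_of_poly a * inverse (fps_of_poly b) *
                     (fps_of_poly d * inverse (fps_of_poly d))"
      unfolding * [symmetric] by (simp only: mult_ac)
    also have "\<dots> = fps_of_poly a * inverse (fps_of_poly b)"
      using inverse_mult_eq_1'[OF nz(2)] by simp
    finally show ?thesis
      using nz by (simp add: fps_divide_unit)
  qed
  thus ?thesis
    unfolding taylor_at_0_def using b by (intro the_equality) blast+
qed

definition mag_coeff :: "nat \<Rightarrow> (nat \<Rightarrow> real) set set \<Rightarrow> nat \<Rightarrow> real" where
  "mag_coeff n \<A> l = fps_nth (taylor_at_0 (magnitude n \<A>)) l"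

end

theory Submission
  imports
    Defs
    "HOL-Complex_Analysis.Complex_Analysis"
    "HOL-Real_Asymp.Real_Asymp"
    "Jordan_Normal_Form.Determinant"
begin

text \<open>
  Give every hyperplane its own weight and let \<open>M\<close> be the magnitude of the matrix whose entries are
  the products of the weights of the separating hyperplanes. If two hyperplanes of weights \<open>y\<close> and
  \<open>z\<close> in a new direction are added so that together with an old hyperplane of weight \<open>x\<close> they form
  a rank 2 subarrangement of three hyperplanes, then the new magnitude is
  \<open>2 / (1 + yz) M(x) + (1 - y) (1 - z) (1 - yz) / ((1 + yz) (1 + y) (1 + z)) M(- xyz)\<close>,
  where \<open>M(x)\<close> is the old magnitude as a function of \<open>x\<close>. Starting from four lines in the plane,
  four such steps give an arrangement of twelve hyperplanes in dimension 6 whose magnitude has a pole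
  of order 5 at \<open>q = i\<close>, but only of order at most 4 at \<open>q = -1\<close>. If the coefficients eventually alternated
  in sign, then \<open>|Mag(ir)|\<close> would be at most \<open>Mag(- r)\<close> plus a constant for \<open>0 < r < 1\<close>, which is
  impossible as \<open>r\<close> tends to 1.
\<close>

section \<open>Weighted magnitudes of sets of sign vectors\<close>

text \<open>General weights are forced by the recursion: it evaluates the old magnitude at
  \<open>- xyz\<close>, so equal weights \<open>q\<close> are not preserved. The pole orders are
  governed by the substitution of \<open>- xyz\<close> for \<open>x\<close>. At
  \<open>x = y = z = i\<close> it returns \<open>i\<close>, and both coefficients have a simple pole
  there, so every triangle raises the order by one unless leading terms cancel. At
  \<open>x = y = z = -1\<close> it returns 1; there the first coefficient is regular, and the simple
  pole of the second one multiplies a magnitude with a weight near 1 instead of -1. The four lines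
  start with a double pole at -1, where both \<open>1 - abcd\<close> and \<open>1 + a\<close>
  vanish, and a simple pole at \<open>i\<close>. With all weights \<open>q\<close>, the orders along
  the construction are 1, 2, 3, 4, 5 at \<open>i\<close> and at most 2, 2, 4, 4, 4 at -1, so the
  fourth triangle decides. The triangles form a tree: two are glued to different lines of the plane,
  and the last two to the two new hyperplanes of the second triangle.\<close>

fun sep_weight :: "'a::comm_ring_1 list \<Rightarrow> bool list \<Rightarrow> bool list \<Rightarrow> 'a" where
  "sep_weight (x # xs) (s # ss) (t # ts) = (if s = t then 1 else x) * sep_weight xs ss ts"
| "sep_weight _ _ _ = 1"

text \<open>With \<open>K\<close> the matrix of entries \<open>sep_weight\<close> (the Varchenko
  matrix), \<open>w\<close> solves \<open>K w = 1\<close>. Its total is the magnitude as soon as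
  \<open>K\<close> is invertible, and a proposed \<open>w\<close> can be checked row by row without
  inverting anything.\<close>

definition has_magnitude :: "'a::field list \<Rightarrow> bool list set \<Rightarrow> 'a \<Rightarrow> bool" where
  "has_magnitude xs T m \<longleftrightarrow>
     (\<exists>w. (\<forall>s\<in>T. (\<Sum>t\<in>T. sep_weight xs s t * w t) = 1) \<and> sum w T = m)"

text \<open>Let \<open>t\<close> be a new coordinate and \<open>e\<close> the form of hyperplane
  \<open>j\<close>. Then \<open>a\<close> and \<open>b\<close> are the signs of \<open>t\<close> and
  \<open>t - e\<close>. They differ exactly if \<open>t\<close> lies strictly between 0 and
  \<open>e\<close>, and then \<open>t\<close> has the sign of \<open>e\<close>. So three chambers
  lie over each old one: two outer ones with \<open>a = b\<close> and a middle one.\<close>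

definition glue_triangle :: "nat \<Rightarrow> bool list set \<Rightarrow> bool list set" where
  "glue_triangle j T = {a # b # s | a b s. s \<in> T \<and> (a = b \<or> a = s ! j)}"

lemma sep_weight_update:
  assumes "j < length xs" "length s = length xs" "length t = length xs"
  shows "sep_weight (xs[j := c * xs ! j]) s t = (if s ! j = t ! j then 1 else c) * sep_weight xs s t"
  using assms
proof (induction xs arbitrary: j s t)
  case Nil
  then show ?case by simp
next
  case (Cons x xs)
  obtain a s' where s: "s = a # s'" using Cons.prems by (cases s) auto
  obtain b t' where t: "t = b # t'" using Cons.prems by (cases t) auto
  show ?case
  proof (cases j)
    case 0
    then show ?thesis by (simp add: s t algebra_simps)
  next
    case (Suc i)
    then have "sep_weight (xs[i := c * xs ! i]) s' t'
        = (if s' ! i = t' ! i then 1 else c) * sep_weight xs s' t'"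
      using Cons.prems s t by (intro Cons.IH) auto
    then show ?thesis using Suc by (simp add: s t mult.left_commute)
  qed
qed

lemma sum_glue_triangle:
  fixes f :: "bool list \<Rightarrow> 'a::comm_monoid_add"
  assumes "finite T"
  shows "sum f (glue_triangle j T) =
    (\<Sum>s\<in>T. f (False # False # s) + f (True # True # s) + f ((s ! j) # (\<not> s ! j) # s))"
proof -
  let ?A = "\<lambda>s. {False # False # s, True # True # s, (s ! j) # (\<not> s ! j) # s}"
  have eq: "glue_triangle j T = (\<Union>s\<in>T. ?A s)"
  proof (intro equalityI subsetI)
    fix x assume "x \<in> glue_triangle j T"
    then obtain a b s where "x = a # b # s" "s \<in> T" "a = b \<or> a = s ! j"
      unfolding glue_triangle_def by blast
    then show "x \<in> (\<Union>s\<in>T. ?A s)"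
      by (cases a; cases b) auto
  next
    fix x assume "x \<in> (\<Union>s\<in>T. ?A s)"
    then obtain s where "s \<in> T" "x \<in> ?A s" by blast
    then show "x \<in> glue_triangle j T"
      unfolding glue_triangle_def by blast
  qed
  have "sum f (\<Union>s\<in>T. ?A s) = (\<Sum>s\<in>T. sum f (?A s))"
  proof (rule sum.UNION_disjoint)
    show "\<forall>s\<in>T. \<forall>t\<in>T. s \<noteq> t \<longrightarrow> ?A s \<inter> ?A t = {}" by blast
  qed (use assms in simp_all)
  also have "\<dots> = (\<Sum>s\<in>T. f (False # False # s) + f (True # True # s) + f ((s ! j) # (\<not> s ! j) # s))"
    by (intro sum.cong refl) (simp add: add.assoc)
  finally show ?thesis by (simp add: eq)
qed

lemma finite_glue_triangle:
  assumes "finite T"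
  shows "finite (glue_triangle j T)"
proof (rule finite_subset)
  show "glue_triangle j T \<subseteq> (\<lambda>(a, b, s). a # b # s) ` (UNIV \<times> UNIV \<times> T)"
  proof
    fix x assume "x \<in> glue_triangle j T"
    then obtain a b s where "x = a # b # s" "s \<in> T"
      unfolding glue_triangle_def by blast
    then show "x \<in> (\<lambda>(a, b, s). a # b # s) ` (UNIV \<times> UNIV \<times> T)"
      by (intro image_eqI[of _ _ "(a, b, s)"]) simp_all
  qed
  show "finite ((\<lambda>(a, b, s). a # b # s) ` ((UNIV :: bool set) \<times> (UNIV :: bool set) \<times> T))"
    using assms by (intro finite_imageI finite_cartesian_product) simp_all
qed

lemma length_glue_triangle:
  assumes "\<And>s. s \<in> T \<Longrightarrow> length s = n" "t \<in> glue_triangle j T"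
  shows "length t = Suc (Suc n)"
proof -
  obtain a b s where "t = a # b # s" "s \<in> T"
    using assms(2) unfolding glue_triangle_def by blast
  then show ?thesis using assms(1) by simp
qed

definition glue_coeff1 :: "'a::field \<Rightarrow> 'a \<Rightarrow> 'a" where
  "glue_coeff1 y z = 2 / (1 + y * z)"

definition glue_coeff2 :: "'a::field \<Rightarrow> 'a \<Rightarrow> 'a" where
  "glue_coeff2 y z = (1 - y) * (1 - z) * (1 - y * z) / ((1 + y * z) * (1 + y) * (1 + z))"

text \<open>This is block elimination. The outer chambers form a product of \<open>T\<close> with a
  two-point space whose points are separated by the weight \<open>yz\<close>; this contributes
  \<open>2 / (1 + yz) * m1\<close>. After eliminating them, the Schur complement on the middle
  chambers is a scalar multiple of the old matrix with the weight \<open>x\<close> of hyperplane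
  \<open>j\<close> replaced by \<open>- xyz\<close>, so the weighting behind \<open>m2\<close>
  solves the rest.\<close>

lemma has_magnitude_glue_triangle:
  fixes xs :: "'a::field list"
  assumes fin: "finite T" and len: "\<And>s. s \<in> T \<Longrightarrow> length s = length xs" and j: "j < length xs"
  assumes m1: "has_magnitude xs T m1"
    and m2: "has_magnitude (xs[j := - (y * z) * xs ! j]) T m2"
    and nz: "1 + y * z \<noteq> 0" "1 + y \<noteq> 0" "1 + z \<noteq> 0"
  shows "has_magnitude (y # z # xs) (glue_triangle j T)
           (glue_coeff1 y z * m1 + glue_coeff2 y z * m2)"
proof -
  obtain w1 where w1: "\<And>s. s \<in> T \<Longrightarrow> (\<Sum>t\<in>T. sep_weight xs s t * w1 t) = 1" "sum w1 T = m1"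
    using m1 unfolding has_magnitude_def by blast
  obtain w2 where w2: "\<And>s. s \<in> T \<Longrightarrow>
      (\<Sum>t\<in>T. sep_weight (xs[j := - (y * z) * xs ! j]) s t * w2 t) = 1" "sum w2 T = m2"
    using m2 unfolding has_magnitude_def by blast
  \<comment> \<open>\<open>A\<close> is the weight of each point of the two-point space. Given
    \<open>B\<close>, the numbers \<open>C\<close> and \<open>D\<close> solve the linear system
    \<open>B1\<close>, \<open>B2\<close>. Finally \<open>B\<close> is fixed by the middle rows,
    which must give \<open>(y + z) * A + (1 - y) * (1 - z) * A = 1\<close>.\<close>
  define A where "A = 1 / (1 + y * z)"
  define B where "B = (1 - y * z) / ((1 + y) * (1 + z))"
  define C where "C = z * (1 - y) / ((1 + z) * (1 + y * z))"
  define D where "D = y * (1 - z) / ((1 + y) * (1 + y * z))"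
  have A1: "A + y * z * A = 1"
    unfolding A_def using nz by (simp add: divide_simps)
  have B0: "B = C + D + glue_coeff2 y z"
    unfolding B_def C_def D_def glue_coeff2_def using nz
    by (simp add: divide_simps) (simp add: algebra_simps)
  have B1: "C + y * z * D = z * B" and B2: "D + y * z * C = y * B"
    unfolding B_def C_def D_def using nz
    by (simp_all add: divide_simps) (simp_all add: algebra_simps)
  have B3: "B - y * D - z * C = (1 - y) * (1 - z) * A"
    and B4: "y * z * B - y * C - z * D = - (y * z) * ((1 - y) * (1 - z) * A)"
    unfolding A_def B_def C_def D_def using nz
    by (simp_all add: divide_simps) (simp_all add: algebra_simps)
  txt \<open>
    The coefficients of \<open>w\<close> make the weight \<open>w2\<close> cancel in the rows \<open>a = b\<close>. In the rows \<open>a \<noteq> b\<close> it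
    enters with the factor \<open>1\<close> on the same side of hyperplane \<open>j\<close> and \<open>- yz\<close> across it, whence the
    modified weight \<open>- xyz\<close>.
  \<close>
  define w where "w = (\<lambda>t. case t of a # b # s \<Rightarrow>
     (if a \<noteq> b then B * w2 s
      else if a = s ! j then A * w1 s - C * w2 s
      else A * w1 s - D * w2 s))"
  have fibre: "w (False # False # t) + w (True # True # t) + w ((t ! j) # (\<not> t ! j) # t)
      = glue_coeff1 y z * w1 t + glue_coeff2 y z * w2 t" for t
  proof -
    have "w (False # False # t) + w (True # True # t) + w ((t ! j) # (\<not> t ! j) # t)
      = (2 * A) * w1 t + (B - C - D) * w2 t"
      unfolding w_def by (cases "t ! j") (simp_all add: algebra_simps)
    then show ?thesis
      by (simp add: A_def B0 glue_coeff1_def)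
  qed
  show ?thesis
    unfolding has_magnitude_def
  proof (intro exI[of _ w] conjI ballI)
    show "sum w (glue_triangle j T) = glue_coeff1 y z * m1 + glue_coeff2 y z * m2"
    proof -
      have "sum w (glue_triangle j T) = (\<Sum>t\<in>T. glue_coeff1 y z * w1 t + glue_coeff2 y z * w2 t)"
        unfolding sum_glue_triangle[OF fin] by (simp only: fibre)
      then show ?thesis
        by (simp add: sum.distrib w1(2) w2(2) flip: sum_distrib_left)
    qed
  next
    fix \<sigma> assume "\<sigma> \<in> glue_triangle j T"
    then obtain a b s where \<sigma>: "\<sigma> = a # b # s" "s \<in> T" "a = b \<or> a = s ! j"
      by (auto simp: glue_triangle_def)
    let ?K = "\<lambda>t. sep_weight xs s t"
    let ?L = "\<lambda>t. sep_weight (xs[j := - (y * z) * xs ! j]) s t"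
    have L: "?L t = (if s ! j = t ! j then 1 else - (y * z)) * ?K t" if "t \<in> T" for t
      using sep_weight_update[OF j, of s t "- (y * z)"] len \<sigma>(2) that by auto
    let ?in = "\<lambda>t. sep_weight (y # z # xs) \<sigma> (False # False # t) * w (False # False # t)
       + sep_weight (y # z # xs) \<sigma> (True # True # t) * w (True # True # t)
       + sep_weight (y # z # xs) \<sigma> ((t ! j) # (\<not> t ! j) # t) * w ((t ! j) # (\<not> t ! j) # t)"
    have "(\<Sum>\<tau>\<in>glue_triangle j T. sep_weight (y # z # xs) \<sigma> \<tau> * w \<tau>) = (\<Sum>t\<in>T. ?in t)"
      by (rule sum_glue_triangle[OF fin])
    also have "\<dots> = 1"
    proof (cases "a = b")
      case True
      \<comment> \<open>The middle chamber over \<open>t\<close> differs from an outer row in the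
        second new sign if \<open>a = t ! j\<close> and in the first one otherwise, so
        \<open>B\<close> enters with the factor \<open>z\<close> or \<open>y\<close>.\<close>
      have "?in t = ?K t * w1 t" for t
      proof (cases "a = t ! j")
        case eq: True
        have "?in t = ?K t * ((A + y * z * A) * w1 t - (C + y * z * D - z * B) * w2 t)"
          unfolding \<sigma>(1) w_def using True eq
          by (cases "t ! j") (simp_all add: algebra_simps)
        then show ?thesis by (simp add: A1 B1)
      next
        case neq: False
        have "?in t = ?K t * ((A + y * z * A) * w1 t - (D + y * z * C - y * B) * w2 t)"
          unfolding \<sigma>(1) w_def using True neq
          by (cases "t ! j") (simp_all add: algebra_simps)
        then show ?thesis by (simp add: A1 B2)
      qed
      then show ?thesis using w1(1)[OF \<sigma>(2)] by simp
    next
      case False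
      then have a: "a = s ! j" "b = (\<not> s ! j)" using \<sigma>(3) by auto
      have in_eq: "?in t = ((y + z) * A) * (?K t * w1 t) + ((1 - y) * (1 - z) * A) * (?L t * w2 t)"
        if "t \<in> T" for t
      proof (cases "s ! j = t ! j")
        case True
        have "?in t = ?K t * (((y + z) * A) * w1 t + (B - y * D - z * C) * w2 t)"
          unfolding \<sigma>(1) w_def using True a
          by (cases "t ! j") (simp_all add: algebra_simps)
        then show ?thesis
          unfolding B3 L[OF that] using True by (simp add: algebra_simps)
      next
        case False
        have "?in t = ?K t * (((y + z) * A) * w1 t + (y * z * B - y * C - z * D) * w2 t)"
          unfolding \<sigma>(1) w_def using False a
          by (cases "t ! j") (simp_all add: algebra_simps)
        then show ?thesis
          unfolding B4 L[OF that] using False by (simp add: algebra_simps)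
      qed
      have "(\<Sum>t\<in>T. ?in t) = (y + z) * A + (1 - y) * (1 - z) * A"
        using w1(1)[OF \<sigma>(2)] w2(1)[OF \<sigma>(2)]
        by (simp add: in_eq sum.distrib flip: sum_distrib_left cong: sum.cong)
      also have "\<dots> = A + y * z * A" by (simp add: algebra_simps)
      finally show ?thesis using A1 by simp
    qed
    finally show "(\<Sum>\<tau>\<in>glue_triangle j T. sep_weight (y # z # xs) \<sigma> \<tau> * w \<tau>) = 1" .
  qed
qed

section \<open>Four lines in the plane\<close>

definition pencil4 :: "bool list set" where
  "pencil4 =
    {[True, True, True, True], [False, True, True, True], [False, False, True, True],
     [False, False, False, True], [False, False, False, False], [True, False, False, False],
     [True, True, False, False], [True, True, True, False]}"

definition pencil4_magnitude :: "'a::field \<Rightarrow> 'a \<Rightarrow> 'a \<Rightarrow> 'a \<Rightarrow> 'a" where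
  "pencil4_magnitude a b c d = 2 / (1 - a * b * c * d) *
     ((1 - a) / (1 + a) + (1 - b) / (1 + b) + (1 - c) / (1 + c) + (1 - d) / (1 + d))"

text \<open>The eight sectors of \<open>pencil4\<close> are listed in cyclic order. Opposite sectors
  receive the same weight, namely \<open>P * (r x + r y - 1)\<close> for a sector bounded by the
  lines of weights \<open>x\<close> and \<open>y\<close>.\<close>

lemma has_magnitude_pencil4:
  fixes a b c d :: "'a::field"
  assumes nz: "1 - a * b * c * d \<noteq> 0" "1 + a \<noteq> 0" "1 + b \<noteq> 0" "1 + c \<noteq> 0" "1 + d \<noteq> 0"
  shows "has_magnitude [a, b, c, d] pencil4 (pencil4_magnitude a b c d)"
proof -
  define P where "P = 1 / (1 - a * b * c * d)"
  define r where "r = (\<lambda>x::'a. 1 / (1 + x))"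
  have r: "r x * (1 + x) = 1" if "1 + x \<noteq> 0" for x
    using that by (simp add: r_def)
  \<comment> \<open>A row sum, with opposite sectors paired. Each \<open>r x\<close> occurs in two
    adjacent pairs of sectors, whose entries add up to a multiple of \<open>1 + x\<close>, so all
    reciprocals disappear. The other rows follow by rotating the weights.\<close>
  have rotate: "(r x4 + r x1 - 1) * (1 + x1 * x2 * x3 * x4) + (r x1 + r x2 - 1) * (x1 + x2 * x3 * x4)
      + (r x2 + r x3 - 1) * (x1 * x2 + x3 * x4) + (r x3 + r x4 - 1) * (x1 * x2 * x3 + x4)
      = 1 - x1 * x2 * x3 * x4"
    if "1 + x1 \<noteq> 0" "1 + x2 \<noteq> 0" "1 + x3 \<noteq> 0" "1 + x4 \<noteq> 0" for x1 x2 x3 x4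
  proof -
    have "(r x4 + r x1 - 1) * (1 + x1 * x2 * x3 * x4) + (r x1 + r x2 - 1) * (x1 + x2 * x3 * x4)
      + (r x2 + r x3 - 1) * (x1 * x2 + x3 * x4) + (r x3 + r x4 - 1) * (x1 * x2 * x3 + x4)
      = (r x1 * (1 + x1)) * (1 + x2 * x3 * x4) + (r x2 * (1 + x2)) * (x1 + x3 * x4)
      + (r x3 * (1 + x3)) * (x1 * x2 + x4) + (r x4 * (1 + x4)) * (1 + x1 * x2 * x3)
      - ((1 + x1 * x2 * x3 * x4) + (x1 + x2 * x3 * x4) + (x1 * x2 + x3 * x4) + (x1 * x2 * x3 + x4))"
      by (simp add: algebra_simps)
    also have "\<dots> = 1 - x1 * x2 * x3 * x4"
      unfolding r[OF that(1)] r[OF that(2)] r[OF that(3)] r[OF that(4)] by (simp add: algebra_simps)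
    finally show ?thesis .
  qed
  define w where "w = (\<lambda>s :: bool list. P *
     (if s ! 0 = s ! 3 then r d + r a - 1 else if s ! 0 \<noteq> s ! 1 then r a + r b - 1
      else if s ! 1 \<noteq> s ! 2 then r b + r c - 1 else r c + r d - 1))"
  have P: "P * (1 - a * b * c * d) = 1"
    using nz by (simp add: P_def)
  have "(\<Sum>t\<in>pencil4. sep_weight [a, b, c, d] s t * w t) = 1" if "s \<in> pencil4" for s
  proof -
    have 1: "P * ((r d + r a - 1) * (1 + a * b * c * d) + (r a + r b - 1) * (a + b * c * d)
      + (r b + r c - 1) * (a * b + c * d) + (r c + r d - 1) * (a * b * c + d)) = 1"
      using P rotate[OF nz(2-5)] by simp
    have 2: "P * ((r a + r b - 1) * (1 + b * c * d * a) + (r b + r c - 1) * (b + c * d * a)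
      + (r c + r d - 1) * (b * c + d * a) + (r d + r a - 1) * (b * c * d + a)) = 1"
      using P rotate[OF nz(3,4,5,2)] by (simp add: mult_ac)
    have 3: "P * ((r b + r c - 1) * (1 + c * d * a * b) + (r c + r d - 1) * (c + d * a * b)
      + (r d + r a - 1) * (c * d + a * b) + (r a + r b - 1) * (c * d * a + b)) = 1"
      using P rotate[OF nz(4,5,2,3)] by (simp add: mult_ac)
    have 4: "P * ((r c + r d - 1) * (1 + d * a * b * c) + (r d + r a - 1) * (d + a * b * c)
      + (r a + r b - 1) * (d * a + b * c) + (r b + r c - 1) * (d * a * b + c)) = 1"
      using P rotate[OF nz(5,2,3,4)] by (simp add: mult_ac)
    show ?thesis
      using that unfolding pencil4_def
      by (elim insertE emptyE; hypsubst)
        ((use 1 2 3 4 in \<open>simp add: w_def algebra_simps\<close>)+)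
  qed
  moreover have "sum w pencil4 = pencil4_magnitude a b c d"
  proof -
    have h: "(1 - x) / (1 + x) = 2 * r x - 1" if "1 + x \<noteq> 0" for x
      using that by (simp add: r_def divide_simps)
    have "sum w pencil4 = 2 * P * ((2 * r a - 1) + (2 * r b - 1) + (2 * r c - 1) + (2 * r d - 1))"
      by (simp add: pencil4_def w_def algebra_simps)
    then show ?thesis
      unfolding pencil4_magnitude_def h[OF nz(2)] h[OF nz(3)] h[OF nz(4)] h[OF nz(5)]
      by (simp add: P_def)
  qed
  ultimately show ?thesis
    unfolding has_magnitude_def by blast
qed

lemma finite_pencil4: "finite pencil4" and length_pencil4: "s \<in> pencil4 \<Longrightarrow> length s = 4"
  by (auto simp: pencil4_def)

section \<open>Chambers and sign vectors\<close>

definition tope_cone :: "nat \<Rightarrow> (nat \<Rightarrow> real) list \<Rightarrow> bool list \<Rightarrow> (nat \<Rightarrow> real) set" where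
  "tope_cone n as s = {x \<in> topspace (Euclidean_space n).
     \<forall>i<length as. if s ! i then linear_form n (as ! i) x > 0 else linear_form n (as ! i) x < 0}"

definition topes :: "nat \<Rightarrow> (nat \<Rightarrow> real) list \<Rightarrow> bool list set" where
  "topes n as = {map (\<lambda>a. linear_form n a x > 0) as | x.
     x \<in> topspace (Euclidean_space n) \<and> (\<forall>a\<in>set as. linear_form n a x \<noteq> 0)}"

lemma finite_topes: "finite (topes n as)"
proof (rule finite_subset)
  show "topes n as \<subseteq> {s. set s \<subseteq> UNIV \<and> length s = length as}"
    by (auto simp: topes_def)
  show "finite {s :: bool list. set s \<subseteq> UNIV \<and> length s = length as}"
    by (rule finite_lists_length_eq) simp
qed

lemma length_topes: "s \<in> topes n as \<Longrightarrow> length s = length as"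
  by (auto simp: topes_def)

lemma linear_form_segment:
  "linear_form n a (\<lambda>i. (1 - t) * x i + t * y i) = (1 - t) * linear_form n a x + t * linear_form n a y"
proof -
  have "a i * ((1 - t) * x i + t * y i) = (1 - t) * (a i * x i) + t * (a i * y i)" for i
    by (simp add: algebra_simps)
  then show ?thesis
    by (simp only: linear_form_def sum.distrib sum_distrib_left)
qed

lemma segment_in_Euclidean_space:
  "x \<in> topspace (Euclidean_space n) \<Longrightarrow> y \<in> topspace (Euclidean_space n) \<Longrightarrow>
    (\<lambda>i. (1 - t) * x i + t * y i) \<in> topspace (Euclidean_space n)"
  by (simp add: topspace_Euclidean_space)

lemma continuous_map_linear_form: "continuous_map (Euclidean_space n) euclideanreal (linear_form n a)"
proof -
  have "continuous_map (Euclidean_space n) euclideanreal (\<lambda>x. x i)" for i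
    unfolding Euclidean_space_def
    by (rule continuous_map_from_subtopology[OF continuous_map_product_projection]) simp
  then have "continuous_map (Euclidean_space n) euclideanreal (\<lambda>x. \<Sum>i<n. a i * x i)"
    by (intro continuous_map_sum continuous_map_real_mult) auto
  then show ?thesis
    by (simp add: linear_form_def[abs_def])
qed

lemma openin_tope_cone: "openin (Euclidean_space n) (tope_cone n as s)"
proof -
  have "openin (Euclidean_space n) {x \<in> topspace (Euclidean_space n).
      if s ! i then linear_form n (as ! i) x > 0 else linear_form n (as ! i) x < 0}" for i
    using openin_continuous_map_preimage[OF continuous_map_linear_form, of "if s ! i then {0<..} else {..<0}" n "as ! i"]
    by (cases "s ! i") simp_all
  then have "openin (Euclidean_space n) (topspace (Euclidean_space n) \<inter> \<Inter>((\<lambda>i. {x \<in> topspace (Euclidean_space n).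
      if s ! i then linear_form n (as ! i) x > 0 else linear_form n (as ! i) x < 0}) ` {..<length as}))"
    by (intro openin_Int_Inter) auto
  moreover have "topspace (Euclidean_space n) \<inter> \<Inter>((\<lambda>i. {x \<in> topspace (Euclidean_space n).
      if s ! i then linear_form n (as ! i) x > 0 else linear_form n (as ! i) x < 0}) ` {..<length as}) = tope_cone n as s"
    unfolding tope_cone_def by blast
  ultimately show ?thesis by simp
qed

lemma path_connectedin_tope_cone: "path_connectedin (Euclidean_space n) (tope_cone n as s)"
  unfolding path_connectedin
proof (intro conjI ballI)
  show "tope_cone n as s \<subseteq> topspace (Euclidean_space n)"
    by (auto simp: tope_cone_def)
next
  fix x y assume x: "x \<in> tope_cone n as s" and y: "y \<in> tope_cone n as s"
  let ?g = "\<lambda>t i. (1 - t) * x i + t * y i"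
  have xt: "x \<in> topspace (Euclidean_space n)" and yt: "y \<in> topspace (Euclidean_space n)"
    using x y by (auto simp: tope_cone_def)
  have "pathin (Euclidean_space n) ?g"
    unfolding pathin_def Euclidean_space_def
  proof (rule continuous_map_into_subtopology)
    show "continuous_map (top_of_set {0..1}) (powertop_real UNIV) ?g"
      unfolding continuous_map_componentwise_UNIV continuous_map_iff_continuous
      by (intro allI continuous_intros)
    show "?g \<in> topspace (top_of_set {0..1}) \<rightarrow> {x. \<forall>i\<ge>n. x i = 0}"
      using segment_in_Euclidean_space[OF xt yt] by (auto simp: topspace_Euclidean_space)
  qed
  moreover have "?g t \<in> tope_cone n as s" if "t \<in> {0..1}" for t
  proof -
    have pos: "(1 - t) * u + t * v > 0" if "u > 0" "v > 0" for u v :: real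
    proof (cases "t = 0")
      case False
      then show ?thesis using \<open>t \<in> {0..1}\<close> that
        by (intro add_nonneg_pos mult_nonneg_nonneg mult_pos_pos) auto
    qed (use that in simp)
    have neg: "(1 - t) * u + t * v < 0" if "u < 0" "v < 0" for u v :: real
      using pos[of "- u" "- v"] that by simp
    show ?thesis
      using x y segment_in_Euclidean_space[OF xt yt, of t] pos neg
      unfolding tope_cone_def by (auto simp: linear_form_segment)
  qed
  ultimately show "\<exists>g. pathin (Euclidean_space n) g \<and> g \<in> {0..1} \<rightarrow> tope_cone n as s \<and> g 0 = x \<and> g 1 = y"
    by (intro exI[of _ ?g]) auto
qed

lemma sign_vector_in_tope_cone:
  assumes "x \<in> topspace (Euclidean_space n)" "\<forall>a\<in>set as. linear_form n a x \<noteq> 0"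
  shows "x \<in> tope_cone n as (map (\<lambda>a. linear_form n a x > 0) as)"
proof -
  have "if map (\<lambda>a. linear_form n a x > 0) as ! i then linear_form n (as ! i) x > 0
      else linear_form n (as ! i) x < 0" if i: "i < length as" for i
  proof -
    have "linear_form n (as ! i) x \<noteq> 0" using assms(2) nth_mem[OF i] by blast
    then have "linear_form n (as ! i) x < 0" if "\<not> linear_form n (as ! i) x > 0"
      using that by linarith
    then show ?thesis unfolding nth_map[OF i] by simp
  qed
  then show ?thesis
    unfolding tope_cone_def length_map mem_Collect_eq using assms(1) by simp
qed

lemma tope_cone_nonempty:
  assumes "s \<in> topes n as"
  obtains x where "x \<in> tope_cone n as s"
proof -
  obtain x where "x \<in> topspace (Euclidean_space n)" "\<forall>a\<in>set as. linear_form n a x \<noteq> 0"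
      "s = map (\<lambda>a. linear_form n a x > 0) as"
    using assms unfolding topes_def by blast
  then have "x \<in> tope_cone n as s"
    by (simp add: sign_vector_in_tope_cone)
  then show ?thesis using that by blast
qed

lemma tope_cone_unique:
  assumes "x \<in> tope_cone n as s" "x \<in> tope_cone n as t" "length s = length as" "length t = length as"
  shows "s = t"
proof (rule nth_equalityI)
  show "length s = length t" using assms by simp
  fix i assume "i < length s"
  then have i: "i < length as" using assms by simp
  show "s ! i = t ! i"
  proof -
    have "if s ! i then linear_form n (as ! i) x > 0 else linear_form n (as ! i) x < 0"
      "if t ! i then linear_form n (as ! i) x > 0 else linear_form n (as ! i) x < 0"
      using assms(1,2) i unfolding tope_cone_def mem_Collect_eq by simp_all
    then show ?thesis by (cases "s ! i"; cases "t ! i") simp_all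
  qed
qed

lemma tope_coneD:
  assumes "x \<in> tope_cone n as s"
  shows "x \<in> topspace (Euclidean_space n)"
    and "i < length as \<Longrightarrow> linear_form n (as ! i) x \<noteq> 0"
    and "i < length as \<Longrightarrow> linear_form n (as ! i) x > 0 \<longleftrightarrow> s ! i"
proof -
  have x: "x \<in> topspace (Euclidean_space n)"
    "\<forall>i<length as. if s ! i then linear_form n (as ! i) x > 0 else linear_form n (as ! i) x < 0"
    using assms unfolding tope_cone_def mem_Collect_eq by simp_all
  show "x \<in> topspace (Euclidean_space n)" by (rule x(1))
  assume i: "i < length as"
  have "if s ! i then linear_form n (as ! i) x > 0 else linear_form n (as ! i) x < 0"
    using x(2) i by simp
  then show "linear_form n (as ! i) x \<noteq> 0" "linear_form n (as ! i) x > 0 \<longleftrightarrow> s ! i"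
    by (cases "s ! i"; simp)+
qed

lemma Union_tope_cones:
  "(\<Union>s\<in>topes n as. tope_cone n as s) = topspace (Euclidean_space n) - \<Union>(hyperplane n ` set as)"
proof (intro equalityI subsetI)
  fix x assume "x \<in> (\<Union>s\<in>topes n as. tope_cone n as s)"
  then obtain s where x: "x \<in> tope_cone n as s" by blast
  have "linear_form n a x \<noteq> 0" if a: "a \<in> set as" for a
  proof -
    obtain i where i: "i < length as" "as ! i = a"
      using a unfolding in_set_conv_nth by blast
    show ?thesis using tope_coneD(2)[OF x i(1)] i(2) by simp
  qed
  then show "x \<in> topspace (Euclidean_space n) - \<Union>(hyperplane n ` set as)"
    using tope_coneD(1)[OF x] by (simp add: hyperplane_def)
next
  fix x assume x: "x \<in> topspace (Euclidean_space n) - \<Union>(hyperplane n ` set as)"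
  let ?s = "map (\<lambda>a. linear_form n a x > 0) as"
  have nz: "\<forall>a\<in>set as. linear_form n a x \<noteq> 0"
    using x by (simp add: hyperplane_def)
  have "?s \<in> topes n as"
    unfolding topes_def mem_Collect_eq using x nz by (intro exI[of _ x]) simp
  moreover have "x \<in> tope_cone n as ?s"
    using x nz by (intro sign_vector_in_tope_cone) simp_all
  ultimately show "x \<in> (\<Union>s\<in>topes n as. tope_cone n as s)" by (rule UN_I)
qed

text \<open>The cones are nonempty, open, path connected and disjoint, and they fill the complement
  of the hyperplanes. The rest of the complement is a union of other cones, so each cone is also
  closed there, and a nonempty connected clopen set is a component.\<close>

lemma chambers_eq_tope_cones: "chambers n (hyperplane n ` set as) = tope_cone n as ` topes n as"
proof -
  let ?C = "topspace (Euclidean_space n) - \<Union>(hyperplane n ` set as)"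
  let ?Y = "subtopology (Euclidean_space n) ?C"
  have top: "topspace ?Y = (\<Union>s\<in>topes n as. tope_cone n as s)"
    unfolding Union_tope_cones by (auto)
  have sub: "tope_cone n as s \<subseteq> ?C" if "s \<in> topes n as" for s
    using that Union_tope_cones[of n as] by blast
  have op: "openin ?Y (tope_cone n as s)" if "s \<in> topes n as" for s
    unfolding openin_subtopology
    by (intro exI[of _ "tope_cone n as s"] conjI openin_tope_cone) (simp add: Int_absorb2[OF sub[OF that]])
  have cl: "closedin ?Y (tope_cone n as s)" if s: "s \<in> topes n as" for s
  proof -
    have "topspace ?Y - tope_cone n as s = (\<Union>t\<in>topes n as - {s}. tope_cone n as t)"
      unfolding top using s tope_cone_unique length_topes by blast
    moreover have "openin ?Y (\<Union>t\<in>topes n as - {s}. tope_cone n as t)"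
      using op by blast
    ultimately show ?thesis
      using s top by (auto simp: closedin_def)
  qed
  have comp: "connected_component_of_set ?Y x = tope_cone n as s" if s: "s \<in> topes n as" and x: "x \<in> tope_cone n as s" for s x
  proof
    have "connectedin ?Y (tope_cone n as s)"
      using path_connectedin_imp_connectedin[OF path_connectedin_tope_cone] sub[OF s]
      by (simp add: connectedin_subtopology)
    then show "tope_cone n as s \<subseteq> connected_component_of_set ?Y x"
      using x by (rule connected_component_of_maximal)
    have "connectedin ?Y (connected_component_of_set ?Y x)"
      by (rule connectedin_connected_component_of)
    then have "connected_component_of_set ?Y x \<subseteq> tope_cone n as s \<or> disjnt (connected_component_of_set ?Y x) (tope_cone n as s)"
      using connectedin_clopen_cases[OF _ cl[OF s] op[OF s]] by blast
    moreover have "x \<in> connected_component_of_set ?Y x"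
      using \<open>tope_cone n as s \<subseteq> connected_component_of_set ?Y x\<close> x by blast
    ultimately show "connected_component_of_set ?Y x \<subseteq> tope_cone n as s"
      using x by (auto simp: disjnt_def)
  qed
  show ?thesis
    unfolding chambers_def connected_components_of_def top
  proof (intro equalityI subsetI)
    fix B assume "B \<in> connected_component_of_set ?Y ` (\<Union>s\<in>topes n as. tope_cone n as s)"
    then show "B \<in> tope_cone n as ` topes n as" using comp by auto
  next
    fix B assume "B \<in> tope_cone n as ` topes n as"
    then obtain s where s: "s \<in> topes n as" "B = tope_cone n as s" by blast
    obtain x where "x \<in> tope_cone n as s" using tope_cone_nonempty[OF s(1)] .
    then show "B \<in> connected_component_of_set ?Y ` (\<Union>s\<in>topes n as. tope_cone n as s)"
      using comp[OF s(1)] s by blast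
  qed
qed

lemma inj_on_tope_cone: "inj_on (tope_cone n as) (topes n as)"
proof (rule inj_onI)
  fix s t assume "s \<in> topes n as" "t \<in> topes n as" "tope_cone n as s = tope_cone n as t"
  then show "s = t"
    using tope_cone_nonempty[of s n as] tope_cone_unique[of _ n as s t] length_topes by metis
qed

text \<open>The normal in \<open>separates\<close> may be any form \<open>a\<close> defining the
  same hyperplane, so it is compared with \<open>as ! i\<close> only through the zero set. On a
  segment between the two cones \<open>a\<close> vanishes somewhere; there \<open>as ! i\<close>
  vanishes as well, so it cannot have the same sign at both ends.\<close>

lemma separates_tope_cone_iff:
  assumes s: "s \<in> topes n as" and t: "t \<in> topes n as" and i: "i < length as"
  shows "separates n (hyperplane n (as ! i)) (tope_cone n as s) (tope_cone n as t) \<longleftrightarrow> s ! i \<noteq> t ! i"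
proof
  assume sep: "separates n (hyperplane n (as ! i)) (tope_cone n as s) (tope_cone n as t)"
  obtain a where a: "hyperplane n (as ! i) = hyperplane n a"
      "\<forall>x\<in>tope_cone n as s. linear_form n a x > 0" "\<forall>x\<in>tope_cone n as t. linear_form n a x < 0"
    using sep unfolding separates_def by blast
  obtain x where x: "x \<in> tope_cone n as s" using tope_cone_nonempty[OF s] .
  obtain y where y: "y \<in> tope_cone n as t" using tope_cone_nonempty[OF t] .
  have xt: "x \<in> topspace (Euclidean_space n)" and yt: "y \<in> topspace (Euclidean_space n)"
    using x y by (auto simp: tope_cone_def)
  define p where "p = linear_form n a x"
  define r where "r = linear_form n a y"
  have pr: "p > 0" "r < 0" using a x y by (auto simp: p_def r_def)
  \<comment> \<open>The parameter at which the segment from \<open>x\<close> to \<open>y\<close>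
    meets the zero set of \<open>a\<close>.\<close>
  define u where "u = p / (p - r)"
  let ?z = "\<lambda>j. (1 - u) * x j + u * y j"
  have u: "0 < u" "u < 1" using pr by (auto simp: u_def)
  have "linear_form n a ?z = (1 - u) * p + u * r"
    by (simp add: linear_form_segment p_def r_def)
  also have "\<dots> = 0" using pr by (simp add: u_def field_simps)
  finally have "?z \<in> hyperplane n a"
    using segment_in_Euclidean_space[OF xt yt, of u] by (simp add: hyperplane_def)
  then have "?z \<in> hyperplane n (as ! i)"
    using a(1) by simp
  then have 0: "(1 - u) * linear_form n (as ! i) x + u * linear_form n (as ! i) y = 0"
    by (simp add: hyperplane_def linear_form_segment)
  have pos: "(1 - u) * c + u * d > 0" if "c > 0" "d > 0" for c d :: real
    using u that by (simp add: add_pos_pos)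
  show "s ! i \<noteq> t ! i"
  proof
    assume eq: "s ! i = t ! i"
    show False
    proof (cases "s ! i")
      case True
      then have "linear_form n (as ! i) x > 0" "linear_form n (as ! i) y > 0"
        using x y i eq by (auto simp: tope_cone_def)
      then show False using pos 0 by force
    next
      case False
      then have "- linear_form n (as ! i) x > 0" "- linear_form n (as ! i) y > 0"
        using x y i eq by (auto simp: tope_cone_def)
      then show False using pos[of "- linear_form n (as ! i) x" "- linear_form n (as ! i) y"] 0 by simp
    qed
  qed
next
  assume neq: "s ! i \<noteq> t ! i"
  \<comment> \<open>\<open>separates\<close> wants the positive side first, so the opposite normal
    is the witness when \<open>s ! i\<close> is false.\<close>
  have m: "linear_form n (\<lambda>j. - (as ! i) j) x = - linear_form n (as ! i) x" for x
    by (simp add: linear_form_def sum_negf)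
  show "separates n (hyperplane n (as ! i)) (tope_cone n as s) (tope_cone n as t)"
  proof (cases "s ! i")
    case True
    then show ?thesis
      unfolding separates_def using neq i by (intro exI[of _ "as ! i"]) (auto simp: tope_cone_def)
  next
    case False
    then show ?thesis
      unfolding separates_def using neq i
      by (intro exI[of _ "\<lambda>j. - (as ! i) j"]) (auto simp: tope_cone_def m hyperplane_def)
  qed
qed

lemma chamber_dist_tope_cone:
  assumes "distinct (map (hyperplane n) as)" "s \<in> topes n as" "t \<in> topes n as"
  shows "chamber_dist n (hyperplane n ` set as) (tope_cone n as s) (tope_cone n as t)
    = card {i. i < length as \<and> s ! i \<noteq> t ! i}"
proof -
  let ?h = "\<lambda>i. hyperplane n (as ! i)"
  have "{H \<in> hyperplane n ` set as. separates n H (tope_cone n as s) (tope_cone n as t)}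
    = ?h ` {i. i < length as \<and> s ! i \<noteq> t ! i}"
  proof (intro equalityI subsetI)
    fix H assume H: "H \<in> {H \<in> hyperplane n ` set as. separates n H (tope_cone n as s) (tope_cone n as t)}"
    then obtain i where "i < length as" "H = ?h i"
      by (auto simp: set_conv_nth)
    then show "H \<in> ?h ` {i. i < length as \<and> s ! i \<noteq> t ! i}"
      using H separates_tope_cone_iff[OF assms(2,3)] by blast
  next
    fix H assume "H \<in> ?h ` {i. i < length as \<and> s ! i \<noteq> t ! i}"
    then obtain i where "i < length as" "s ! i \<noteq> t ! i" "H = ?h i" by blast
    then show "H \<in> {H \<in> hyperplane n ` set as. separates n H (tope_cone n as s) (tope_cone n as t)}"
      using separates_tope_cone_iff[OF assms(2,3)] by simp
  qed
  moreover have "inj_on ?h {i. i < length as \<and> s ! i \<noteq> t ! i}"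
    using assms(1) by (auto simp: inj_on_def distinct_conv_nth)
  ultimately show ?thesis
    by (simp add: chamber_dist_def card_image)
qed

section \<open>Inverting the matrix over the rational functions\<close>

lemma comm_ring_hom_to_fract: "comm_ring_hom (to_fract :: 'a::idom \<Rightarrow> 'a fract)"
  by unfold_locales (simp_all add: to_fract_def Fract_of_int_eq[symmetric] One_fract_def Zero_fract_def)

lemma comm_ring_hom_poly0: "comm_ring_hom (\<lambda>p :: 'a::comm_ring_1 poly. poly p x)"
  by unfold_locales simp_all

text \<open>At 0 the matrix becomes the identity. Its determinant is therefore a polynomial with
  value 1 at 0, hence a nonzero element of the fraction field.\<close>

lemma ex_is_inverse_on_to_fract:
  fixes P :: "'b \<Rightarrow> 'b \<Rightarrow> real poly"
  assumes fin: "finite S"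
    and P0: "\<And>B C. B \<in> S \<Longrightarrow> C \<in> S \<Longrightarrow> poly (P B C) 0 = (if B = C then 1 else 0)"
  shows "\<exists>L. is_inverse_on S (\<lambda>B C. to_fract (P B C)) L"
proof -
  define m where "m = card S"
  obtain e where e: "bij_betw e {0..<m} S"
    using ex_bij_betw_nat_finite[OF fin] unfolding m_def by blast
  define A where "A = Matrix.mat m m (\<lambda>(i, j). P (e i) (e j))"
  have A: "A \<in> carrier_mat m m" by (simp add: A_def)
  interpret ev: comm_ring_hom "\<lambda>p :: real poly. poly p 0" by (rule comm_ring_hom_poly0)
  interpret fr: comm_ring_hom "to_fract :: real poly \<Rightarrow> real poly fract" by (rule comm_ring_hom_to_fract)
  have eS: "e i \<in> S" if "i < m" for i
    using e that by (auto simp: bij_betw_def)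
  have einj: "e i = e j \<longleftrightarrow> i = j" if "i < m" "j < m" for i j
    using e that by (auto simp: bij_betw_def inj_on_def)
  have "map_mat (\<lambda>p. poly p 0) A = 1\<^sub>m m"
    by (rule eq_matI) (auto simp: A_def P0 eS einj)
  then have "poly (Determinant.det A) 0 = 1"
    by (metis ev.hom_det det_one)
  then have "Determinant.det A \<noteq> 0" by auto
  let ?F = "map_mat to_fract A"
  have F: "?F \<in> carrier_mat m m" using A by simp
  have "Determinant.det ?F = to_fract (Determinant.det A)"
    by (rule fr.hom_det)
  then have "Determinant.det ?F \<noteq> 0"
    using \<open>Determinant.det A \<noteq> 0\<close> by simp
  then obtain G where G: "G \<in> carrier_mat m m" "G * ?F = 1\<^sub>m m" "?F * G = 1\<^sub>m m"
    using det_non_zero_imp_unit[OF F, of "()"] unfolding Units_def ring_mat_def by auto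
  define f where "f = inv_into {0..<m} e"
  have fe: "f (e i) = i" if "i < m" for i
    using e that by (simp add: f_def bij_betw_def)
  have surj: "\<exists>i<m. B = e i" if "B \<in> S" for B
    using e that by (auto simp: bij_betw_def)
  have sumS: "(\<Sum>D\<in>S. h D) = (\<Sum>k = 0..<m. h (e k))" for h :: "'b \<Rightarrow> real poly fract"
    using sum.reindex_bij_betw[OF e, of h] by simp
  have "is_inverse_on S (\<lambda>B C. to_fract (P B C)) (\<lambda>B C. G $$ (f B, f C))"
    unfolding is_inverse_on_def
  proof (intro ballI)
    fix B C assume "B \<in> S" "C \<in> S"
    then obtain i j where i: "i < m" "B = e i" and j: "j < m" "C = e j"
      using surj by metis
    have "(\<Sum>D\<in>S. to_fract (P B D) * G $$ (f D, f C)) = (?F * G) $$ (i, j)"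
      using i j G(1) by (simp add: sumS fe scalar_prod_def A_def)
    moreover have "(\<Sum>D\<in>S. G $$ (f B, f D) * to_fract (P D C)) = (G * ?F) $$ (i, j)"
      using i j G(1) by (simp add: sumS fe scalar_prod_def A_def)
    ultimately show "(\<Sum>D\<in>S. to_fract (P B D) * G $$ (f D, f C)) = (if B = C then 1 else 0) \<and>
        (\<Sum>D\<in>S. G $$ (f B, f D) * to_fract (P D C)) = (if B = C then 1 else 0)"
      using i j G(2,3) einj by simp
  qed
  then show ?thesis by blast
qed

text \<open>Applying the inverse to \<open>K w = 1\<close> shows that its row sums are the entries
  of \<open>w\<close>.\<close>

lemma sum_inverse_on_eq:
  fixes K :: "'b \<Rightarrow> 'b \<Rightarrow> 'a::comm_semiring_1"
  assumes fin: "finite S" and inv: "is_inverse_on S K L"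
    and w: "\<And>B. B \<in> S \<Longrightarrow> (\<Sum>C\<in>S. K B C * w C) = 1"
  shows "(\<Sum>B\<in>S. \<Sum>C\<in>S. inverse_on S K B C) = sum w S"
proof (rule sum.cong[OF refl])
  fix B assume B: "B \<in> S"
  have "(\<Sum>C\<in>S. inverse_on S K B C) = (\<Sum>C\<in>S. L B C * (\<Sum>D\<in>S. K C D * w D))"
    using inverse_on_eq[OF fin inv B] w by simp
  also have "\<dots> = (\<Sum>C\<in>S. \<Sum>D\<in>S. L B C * K C D * w D)"
    by (simp add: sum_distrib_left mult.assoc)
  also have "\<dots> = (\<Sum>D\<in>S. \<Sum>C\<in>S. L B C * K C D * w D)"
    by (rule sum.swap)
  also have "\<dots> = (\<Sum>D\<in>S. (\<Sum>C\<in>S. L B C * K C D) * w D)"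
    by (simp add: sum_distrib_right)
  also have "\<dots> = (\<Sum>D\<in>S. (if B = D then 1 else 0) * w D)"
    using inv B by (intro sum.cong) (auto simp: is_inverse_on_def)
  also have "\<dots> = (\<Sum>D\<in>S. if B = D then w D else 0)"
    by (intro sum.cong) auto
  also have "\<dots> = w B"
    using fin B by simp
  finally show "(\<Sum>C\<in>S. inverse_on S K B C) = w B" .
qed

lemma sep_weight_replicate:
  assumes "length s = m" "length t = m"
  shows "sep_weight (replicate m x) s t = x ^ card {i. i < m \<and> s ! i \<noteq> t ! i}"
  using assms
proof (induction m arbitrary: s t)
  case (Suc m)
  obtain a s' where s: "s = a # s'" using Suc.prems by (cases s) auto
  obtain b t' where t: "t = b # t'" using Suc.prems by (cases t) auto
  have "{i. i < Suc m \<and> s ! i \<noteq> t ! i}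
      = (if a = b then {} else {0}) \<union> Suc ` {i. i < m \<and> s' ! i \<noteq> t' ! i}"
    by (auto simp: s t image_iff less_Suc_eq_0_disj)
  also have "card \<dots> = (if a = b then 0 else 1) + card {i. i < m \<and> s' ! i \<noteq> t' ! i}"
    by (subst card_Un_disjoint) (auto simp: card_image)
  finally show ?case
    using Suc by (simp add: s t)
qed simp

lemma magnitude_eq_has_magnitude:
  assumes dist: "distinct (map (hyperplane n) as)"
    and m: "has_magnitude (replicate (length as) q_var) (topes n as) m"
  shows "magnitude n (hyperplane n ` set as) = m"
proof -
  let ?A = "hyperplane n ` set as" and ?T = "topes n as" and ?c = "tope_cone n as"
  have ch: "chambers n ?A = ?c ` ?T" by (rule chambers_eq_tope_cones)
  have fin: "finite (?c ` ?T)" by (simp add: finite_topes)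
  have K: "K_matrix n ?A (?c s) (?c t) = sep_weight (replicate (length as) q_var) s t"
    if "s \<in> ?T" "t \<in> ?T" for s t
    using that by (simp add: K_matrix_def chamber_dist_tope_cone[OF dist] sep_weight_replicate length_topes)
  obtain w where w: "\<forall>s\<in>?T. (\<Sum>t\<in>?T. sep_weight (replicate (length as) q_var) s t * w t) = 1" "sum w ?T = m"
    using m unfolding has_magnitude_def by blast
  define v where "v = (\<lambda>B. w (inv_into ?T ?c B))"
  have v: "v (?c t) = w t" if "t \<in> ?T" for t
    using that by (simp add: v_def inv_into_f_f[OF inj_on_tope_cone])
  have sumc: "(\<Sum>B\<in>?c ` ?T. h B) = (\<Sum>t\<in>?T. h (?c t))" for h :: "_ \<Rightarrow> real poly fract"
    by (simp add: sum.reindex[OF inj_on_tope_cone])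
  have "K_matrix n ?A = (\<lambda>B C. to_fract ([:0, 1:] ^ chamber_dist n ?A B C))"
  proof (intro ext)
    interpret fr: comm_ring_hom "to_fract :: real poly \<Rightarrow> real poly fract" by (rule comm_ring_hom_to_fract)
    show "K_matrix n ?A B C = to_fract ([:0, 1:] ^ chamber_dist n ?A B C)" for B C
      by (simp add: K_matrix_def q_var_def fr.hom_power)
  qed
  \<comment> \<open>At \<open>q = 0\<close> only entries of distance 0 survive, and distinct topes
    differ in at least one sign.\<close>
  moreover have "\<exists>L. is_inverse_on (?c ` ?T) (\<lambda>B C. to_fract ([:0, 1 :: real:] ^ chamber_dist n ?A B C)) L"
  proof (rule ex_is_inverse_on_to_fract[OF fin, where P = "\<lambda>B C. [:0, 1:] ^ chamber_dist n ?A B C"])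
    fix B C assume "B \<in> ?c ` ?T" "C \<in> ?c ` ?T"
    then obtain s t where s: "s \<in> ?T" "B = ?c s" and t: "t \<in> ?T" "C = ?c t" by blast
    have "s = t \<longleftrightarrow> (\<forall>i<length as. s ! i = t ! i)"
      using length_topes[OF s(1)] length_topes[OF t(1)] by (simp add: list_eq_iff_nth_eq)
    then have "card {i. i < length as \<and> s ! i \<noteq> t ! i} = 0 \<longleftrightarrow> s = t"
      by auto
    moreover have "B = C \<longleftrightarrow> s = t"
      using inj_on_eq_iff[OF inj_on_tope_cone s(1) t(1)] s(2) t(2) by simp
    ultimately show "poly ([:0, 1:] ^ chamber_dist n ?A B C) 0 = (if B = C then 1 else (0::real))"
      using s t by (simp add: chamber_dist_tope_cone[OF dist] power_0_left)
  qed
  ultimately obtain L where L: "is_inverse_on (?c ` ?T) (K_matrix n ?A) L" by auto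
  have "magnitude n ?A = sum v (?c ` ?T)"
    unfolding magnitude_def ch
  proof (rule sum_inverse_on_eq[OF fin L])
    fix B assume "B \<in> ?c ` ?T"
    then obtain s where s: "s \<in> ?T" "B = ?c s" by blast
    have "(\<Sum>C\<in>?c ` ?T. K_matrix n ?A B C * v C) = (\<Sum>t\<in>?T. sep_weight (replicate (length as) q_var) s t * w t)"
      unfolding sumc using s by (intro sum.cong refl) (simp add: K v)
    then show "(\<Sum>C\<in>?c ` ?T. K_matrix n ?A B C * v C) = 1"
      using w(1) s(1) by simp
  qed
  also have "\<dots> = m"
    using w(2) by (simp add: sumc v)
  finally show ?thesis .
qed

section \<open>Adding triangles to an arrangement\<close>

text \<open>\<open>hyperplane n a\<close> does not see the coordinates of \<open>a\<close> from
  \<open>n\<close> on. They are required to vanish because the dimension will grow, and an old form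
  must not involve the coordinate that is added next.\<close>

definition realizes :: "nat \<Rightarrow> (nat \<Rightarrow> real) list \<Rightarrow> bool list set \<Rightarrow> bool" where
  "realizes n as T \<longleftrightarrow> (\<forall>a\<in>set as. (\<exists>i<n. a i \<noteq> 0) \<and> (\<forall>i\<ge>n. a i = 0)) \<and>
     distinct (map (hyperplane n) as) \<and> topes n as = T"

text \<open>These are the forms \<open>t\<close> and \<open>t - e\<close>, with \<open>t\<close> the
  coordinate of index \<open>n\<close> and \<open>e = as ! j\<close>. Their difference is
  \<open>e\<close>, so the three hyperplanes have a common intersection of codimension 2.\<close>

definition glue_forms :: "nat \<Rightarrow> nat \<Rightarrow> (nat \<Rightarrow> real) list \<Rightarrow> (nat \<Rightarrow> real) list" where
  "glue_forms n j as = (\<lambda>i. if i = n then 1 else 0) # (\<lambda>i. if i = n then 1 else - (as ! j) i) # as"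

lemma linear_form_Suc: "linear_form (Suc n) a x = linear_form n a x + a n * x n"
  by (simp add: linear_form_def)

lemma linear_form_upd: "linear_form n a (x(n := v)) = linear_form n a x"
  by (simp add: linear_form_def)

lemma topspace_Euclidean_space_upd:
  "x \<in> topspace (Euclidean_space (Suc n)) \<Longrightarrow> x(n := 0) \<in> topspace (Euclidean_space n)"
  "x \<in> topspace (Euclidean_space n) \<Longrightarrow> x(n := v) \<in> topspace (Euclidean_space (Suc n))"
  by (auto simp: topspace_Euclidean_space)

lemma realizes_glue_forms:
  assumes R: "realizes n as T" and j: "j < length as"
  shows "realizes (Suc n) (glue_forms n j as) (glue_triangle j T)"
proof -
  define e where "e = as ! j"
  define u where "u = (\<lambda>i. if i = n then 1 else 0 :: real)"
  define v where "v = (\<lambda>i. if i = n then 1 else - e i)"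
  have forms: "glue_forms n j as = u # v # as"
    unfolding glue_forms_def u_def v_def e_def ..
  have e: "e \<in> set as" using j by (simp add: e_def)
  have supp: "\<exists>i<n. a i \<noteq> 0" "\<And>i. i \<ge> n \<Longrightarrow> a i = 0" if "a \<in> set as" for a
    using R that by (simp_all add: realizes_def)
  have T: "topes n as = T" and dist: "distinct (map (hyperplane n) as)"
    using R by (simp_all add: realizes_def)
  have old: "linear_form (Suc n) a x = linear_form n a x" if "a \<in> set as" for a x
    using supp(2)[OF that, of n] by (simp add: linear_form_Suc)
  have lu: "linear_form (Suc n) u x = x n" for x
    by (simp add: linear_form_def u_def)
  have lv: "linear_form (Suc n) v x = x n - linear_form n e x" for x
    by (simp add: linear_form_def v_def sum_negf)
  have 1: "(\<exists>i<Suc n. a i \<noteq> 0) \<and> (\<forall>i\<ge>Suc n. a i = 0)" if a: "a \<in> set (u # v # as)" for a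
  proof -
    consider "a = u" | "a = v" | "a \<in> set as" using a by auto
    then show ?thesis
    proof cases
      case 3
      then show ?thesis using supp[OF 3] less_Suc_eq by (metis Suc_leD)
    next
      case 2
      then show ?thesis using supp(2)[OF e] by (auto simp: v_def intro!: exI[of _ n])
    qed (auto simp: u_def)
  qed
  have 2: "distinct (map (hyperplane (Suc n)) (u # v # as))"
  proof -
    \<comment> \<open>Cutting with the old space recovers the old hyperplane, so distinct old
      hyperplanes stay distinct.\<close>
    have restrict: "hyperplane n a = hyperplane (Suc n) a \<inter> topspace (Euclidean_space n)" if "a \<in> set as" for a
      using old[OF that] by (auto simp: hyperplane_def topspace_Euclidean_space)
    have "inj_on (hyperplane n) (set as)" "distinct as"
      using dist by (simp_all add: distinct_map)
    then have "inj_on (hyperplane (Suc n)) (set as)"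
      unfolding inj_on_def using restrict by metis
    then have d: "distinct (map (hyperplane (Suc n)) as)"
      using \<open>distinct as\<close> by (simp add: distinct_map)
    \<comment> \<open>Read as a point, \<open>u\<close> is the new basis vector. It lies on all old
      hyperplanes and on neither of the new ones.\<close>
    have u_old: "u \<in> hyperplane (Suc n) a" if "a \<in> set as" for a
    proof -
      have "linear_form n a u = 0"
        by (simp add: linear_form_def u_def)
      then show ?thesis
        by (simp add: hyperplane_def old[OF that] topspace_Euclidean_space u_def)
    qed
    have u_new: "u \<notin> hyperplane (Suc n) u" "u \<notin> hyperplane (Suc n) v"
      by (simp_all add: hyperplane_def lu lv) (simp_all add: linear_form_def u_def)
    obtain i where i: "i < n" "e i \<noteq> 0" using supp(1)[OF e] by blast
    let ?x = "\<lambda>k. if k = i then 1 else 0 :: real"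
    have "linear_form n e ?x = (\<Sum>k<n. if k = i then e i else 0)"
      unfolding linear_form_def by (intro sum.cong) auto
    then have "linear_form n e ?x = e i" using i by simp
    then have "?x \<in> hyperplane (Suc n) u" "?x \<notin> hyperplane (Suc n) v"
      using i by (simp_all add: hyperplane_def lu lv topspace_Euclidean_space)
    then have "hyperplane (Suc n) u \<noteq> hyperplane (Suc n) v" by metis
    moreover have "hyperplane (Suc n) u \<notin> hyperplane (Suc n) ` set as"
      "hyperplane (Suc n) v \<notin> hyperplane (Suc n) ` set as"
      using u_old u_new by (metis imageE)+
    ultimately show ?thesis using d by simp
  qed
  have 3: "topes (Suc n) (u # v # as) = glue_triangle j T"
  proof (intro equalityI subsetI)
    fix \<sigma> assume "\<sigma> \<in> topes (Suc n) (u # v # as)"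
    then obtain x where x: "x \<in> topspace (Euclidean_space (Suc n))"
        "\<forall>a\<in>set (u # v # as). linear_form (Suc n) a x \<noteq> 0"
        "\<sigma> = map (\<lambda>a. linear_form (Suc n) a x > 0) (u # v # as)"
      unfolding topes_def by blast
    let ?s = "map (\<lambda>a. linear_form n a (x(n := 0)) > 0) as"
    have nz: "\<forall>a\<in>set as. linear_form n a (x(n := 0)) \<noteq> 0"
      using x(2) old by (simp add: linear_form_upd)
    then have s: "?s \<in> T"
      unfolding T[symmetric] topes_def mem_Collect_eq using topspace_Euclidean_space_upd(1)[OF x(1)]
      by (intro exI[of _ "x(n := 0)"]) simp
    have eq: "\<sigma> = (x n > 0) # (x n - linear_form n e x > 0) # ?s"
      using x(3) old by (simp add: lu lv linear_form_upd)
    have sj: "?s ! j = (linear_form n e x > 0)"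
      using j by (simp add: linear_form_upd e_def)
    have "linear_form n e x \<noteq> 0"
      using nz e by (simp add: linear_form_upd)
    then have "(x n > 0) = (x n - linear_form n e x > 0) \<or> (x n > 0) = ?s ! j"
      unfolding sj by (cases "x n > 0"; cases "linear_form n e x > 0"; linarith)
    then show "\<sigma> \<in> glue_triangle j T"
      unfolding glue_triangle_def mem_Collect_eq eq using s by blast
  next
    fix \<sigma> assume "\<sigma> \<in> glue_triangle j T"
    then obtain a b s where \<sigma>: "\<sigma> = a # b # s" "s \<in> T" "a = b \<or> a = s ! j"
      unfolding glue_triangle_def by blast
    then obtain x where x: "x \<in> topspace (Euclidean_space n)" "\<forall>a\<in>set as. linear_form n a x \<noteq> 0"
        "s = map (\<lambda>a. linear_form n a x > 0) as"
      unfolding T[symmetric] topes_def by blast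
    define c where "c = linear_form n e x"
    have c: "c \<noteq> 0" "s ! j = (c > 0)"
      using x e j by (simp_all add: c_def e_def)
    \<comment> \<open>The new coordinate: outside the interval between 0 and \<open>c\<close> on the
      required side, or at its midpoint if the two new signs differ.\<close>
    define y where "y = (if a \<and> b then \<bar>c\<bar> + 1 else if \<not> a \<and> \<not> b then - \<bar>c\<bar> - 1 else c / 2)"
    have y: "y \<noteq> 0" "y - c \<noteq> 0" "a = (y > 0)" "b = (y - c > 0)"
      using \<sigma>(3) c by (auto simp: y_def split: if_splits)
    have "\<sigma> = map (\<lambda>a. linear_form (Suc n) a (x(n := y)) > 0) (u # v # as)"
      using \<sigma>(1) x(3) y(3,4) old by (simp add: lu lv linear_form_upd c_def)
    moreover have "\<forall>a\<in>set (u # v # as). linear_form (Suc n) a (x(n := y)) \<noteq> 0"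
      using x(2) y(1,2) old by (simp add: lu lv linear_form_upd c_def)
    ultimately show "\<sigma> \<in> topes (Suc n) (u # v # as)"
      unfolding topes_def mem_Collect_eq using topspace_Euclidean_space_upd(2)[OF x(1)] by blast
  qed
  show ?thesis
    unfolding realizes_def forms using 1 2 3 by blast
qed

section \<open>Realizing the four lines\<close>

definition plane_form :: "real \<Rightarrow> real \<Rightarrow> nat \<Rightarrow> real" where
  "plane_form a b = (\<lambda>i. if i = 0 then a else if i = 1 then b else 0)"

text \<open>The normals point in the directions 0, 45, 90 and 135 degrees. With this ordering and
  orientation, going round the circle flips the signs one after the other, as in
  \<open>pencil4\<close>.\<close>

definition pencil4_forms :: "(nat \<Rightarrow> real) list" where
  "pencil4_forms = [plane_form 1 0, plane_form 1 1, plane_form 0 1, plane_form (-1) 1]"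

lemma linear_form_plane_form: "linear_form 2 (plane_form a b) x = a * x 0 + b * x 1"
  by (simp add: linear_form_def plane_form_def numeral_2_eq_2)

lemma realizes_pencil4: "realizes 2 pencil4_forms pencil4"
proof -
  have 1: "(\<exists>i<2. a i \<noteq> 0) \<and> (\<forall>i\<ge>2. a i = 0)" if "a \<in> set pencil4_forms" for a
    using that unfolding pencil4_forms_def
    by (auto simp: plane_form_def intro: exI[of _ "0::nat"] exI[of _ "1::nat"])
  have mem: "plane_form c d \<in> hyperplane 2 (plane_form a b) \<longleftrightarrow> a * c + b * d = 0" for a b c d
    by (simp add: hyperplane_def linear_form_plane_form topspace_Euclidean_space) (simp add: plane_form_def)
  have neq: "hyperplane 2 (plane_form a b) \<noteq> hyperplane 2 (plane_form c d)" if "a * d - b * c \<noteq> 0" for a b c d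
  proof
    assume "hyperplane 2 (plane_form a b) = hyperplane 2 (plane_form c d)"
    moreover have "plane_form (- b) a \<in> hyperplane 2 (plane_form a b)" by (simp add: mem)
    ultimately have "plane_form (- b) a \<in> hyperplane 2 (plane_form c d)" by simp
    then show False using that by (simp add: mem algebra_simps)
  qed
  have 2: "distinct (map (hyperplane 2) pencil4_forms)"
    by (simp add: pencil4_forms_def neq)
  have 3: "topes 2 pencil4_forms = pencil4"
  proof (intro equalityI subsetI)
    fix s assume "s \<in> topes 2 pencil4_forms"
    then obtain x where "\<forall>a\<in>set pencil4_forms. linear_form 2 a x \<noteq> 0"
        and s: "s = map (\<lambda>a. linear_form 2 a x > 0) pencil4_forms"
      unfolding topes_def by blast
    then have nz: "x 0 \<noteq> 0" "x 0 + x 1 \<noteq> 0" "x 1 \<noteq> 0" "x 1 - x 0 \<noteq> 0"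
      by (simp_all add: pencil4_forms_def linear_form_plane_form)
    have s: "s = [x 0 > 0, x 0 + x 1 > 0, x 1 > 0, x 1 - x 0 > 0]"
      unfolding s by (simp add: pencil4_forms_def linear_form_plane_form)
    show "s \<in> pencil4"
      using nz unfolding s pencil4_def
      by (cases "x 0 > 0"; cases "x 0 + x 1 > 0"; cases "x 1 > 0"; cases "x 1 - x 0 > 0"; simp; linarith)
  next
    fix s assume s: "s \<in> pencil4"
    have "[p > 0, p + q > 0, q > 0, q - p > 0] \<in> topes 2 pencil4_forms"
      if "p \<noteq> 0" "p + q \<noteq> 0" "q \<noteq> 0" "q - p \<noteq> 0" for p q :: real
      unfolding topes_def mem_Collect_eq using that
      by (intro exI[of _ "plane_form p q"])
        (simp add: pencil4_forms_def linear_form_plane_form topspace_Euclidean_space, simp add: plane_form_def)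
    \<comment> \<open>One point in each sector, in the order in which \<open>pencil4\<close> lists
      the sign vectors.\<close>
    from this[of 1 2] this[of "-1" 2] this[of "-2" 1] this[of "-2" "-1"]
      this[of "-1" "-2"] this[of 1 "-2"] this[of 2 "-1"] this[of 2 1]
    show "s \<in> topes 2 pencil4_forms"
      using s unfolding pencil4_def by auto
  qed
  show ?thesis unfolding realizes_def using 1 2 3 by blast
qed

section \<open>Taylor coefficients and poles on the unit circle\<close>

text \<open>A variant of Pringsheim's argument. From \<open>M\<close> on, the terms of the series at
  \<open>- r\<close> equal their absolute values, so the value at \<open>- r\<close> controls the
  modulus at every point of the circle of radius \<open>r\<close>, up to finitely many
  terms.\<close>

lemma not_eventually_alternating:
  fixes c :: "nat \<Rightarrow> real" and g :: "complex \<Rightarrow> complex"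
  assumes sums: "\<And>z. norm z < 1 \<Longrightarrow> (\<lambda>l. of_real (c l) * z ^ l) sums g z"
    and k: "k > 0" and \<zeta>: "norm \<zeta> = 1"
    and lim1: "((\<lambda>r. of_real (1 - r) ^ k * g (- of_real r)) \<longlongrightarrow> 0) (at_left (1::real))"
    and lim2: "((\<lambda>r. of_real (1 - r) ^ k * g (\<zeta> * of_real r)) \<longlongrightarrow> L) (at_left (1::real))"
    and L: "L \<noteq> 0"
  shows "\<not> (\<forall>\<^sub>F l in sequentially. (-1) ^ l * c l \<ge> 0)"
proof
  assume "\<forall>\<^sub>F l in sequentially. (-1) ^ l * c l \<ge> 0"
  then obtain M where M: "\<And>l. l \<ge> M \<Longrightarrow> (-1) ^ l * c l \<ge> 0"
    unfolding eventually_sequentially by blast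
  \<comment> \<open>For \<open>l < M\<close> the term at \<open>- r\<close> may be as low as
    \<open>- |c l|\<close>, while the modulus is at most \<open>|c l|\<close>; this costs
    \<open>2 * |c l|\<close>.\<close>
  define C where "C = (\<Sum>l<M. 2 * \<bar>c l\<bar>)"
  have bound: "norm (g (\<zeta> * of_real r)) \<le> norm (g (- of_real r)) + C" if r: "0 < r" "r < 1" for r
  proof -
    define d where "d = (\<lambda>l. c l * (- r) ^ l)"
    define b where "b = (\<lambda>l. if l < M then 2 * \<bar>c l\<bar> else 0)"
    have "(\<lambda>l. of_real (c l) * (- of_real r) ^ l) sums g (- of_real r)"
      using r by (intro sums) simp
    then have "(\<lambda>l. Re (of_real (c l) * (- of_real r) ^ l)) sums Re (g (- of_real r))"
      by (rule sums_Re)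
    moreover have "Re (of_real (c l) * (- of_real r) ^ l) = d l" for l
    proof -
      have "of_real (c l) * (- of_real r) ^ l = (of_real (d l) :: complex)"
        by (simp add: d_def)
      then show ?thesis by simp
    qed
    ultimately have d: "d sums Re (g (- of_real r))" by simp
    have b: "b sums C"
      unfolding b_def C_def using sums_If_finite_set[of "{..<M}" "\<lambda>l. 2 * \<bar>c l\<bar>"] by simp
    have le: "norm (of_real (c l) * (\<zeta> * of_real r) ^ l) \<le> d l + b l" for l
    proof -
      have n: "norm (of_real (c l) * (\<zeta> * of_real r) ^ l) = \<bar>c l\<bar> * r ^ l"
        using r \<zeta> by (simp add: norm_mult norm_power)
      have dl: "d l = ((-1) ^ l * c l) * r ^ l"
        by (simp add: d_def power_minus[of r])
      have rl: "0 \<le> r ^ l" "r ^ l \<le> 1" using r by (simp_all add: power_le_one)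
      show ?thesis
      proof (cases "l < M")
        case True
        have "\<bar>(-1) ^ l * c l\<bar> = \<bar>c l\<bar>" by (simp add: abs_mult)
        then have "- \<bar>c l\<bar> * r ^ l \<le> d l"
          unfolding dl using rl(1) by (intro mult_right_mono) auto
        moreover have "\<bar>c l\<bar> * r ^ l \<le> \<bar>c l\<bar>"
          using rl by (simp add: mult_left_le)
        ultimately show ?thesis using True unfolding n b_def by simp
      next
        case False
        then have "(-1) ^ l * c l \<ge> 0" using M by simp
        then have "(-1) ^ l * c l = \<bar>(-1) ^ l * c l\<bar>" by simp
        also have "\<dots> = \<bar>c l\<bar>" by (simp add: abs_mult)
        finally have "(-1) ^ l * c l = \<bar>c l\<bar>" .
        then show ?thesis unfolding n dl b_def using False by simp
      qed
    qed
    have db: "(\<lambda>l. d l + b l) sums (Re (g (- of_real r)) + C)"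
      using d b by (rule sums_add)
    have z: "(\<lambda>l. of_real (c l) * (\<zeta> * of_real r) ^ l) sums g (\<zeta> * of_real r)"
      using r \<zeta> by (intro sums) (simp add: norm_mult)
    have "norm (g (\<zeta> * of_real r)) = norm (\<Sum>l. of_real (c l) * (\<zeta> * of_real r) ^ l)"
      using sums_unique[OF z] by simp
    also have "\<dots> \<le> (\<Sum>l. d l + b l)"
      using le sums_summable[OF db] by (intro norm_suminf_le) auto
    also have "\<dots> = Re (g (- of_real r)) + C"
      using sums_unique[OF db] by simp
    also have "\<dots> \<le> norm (g (- of_real r)) + C"
      using complex_Re_le_cmod by simp
    finally show ?thesis .
  qed
  \<comment> \<open>Since \<open>k > 0\<close>, the factor \<open>(1 - r) ^ k\<close> also kills the
    constant \<open>C\<close>.\<close>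
  have "((\<lambda>r. norm (of_real (1 - r) ^ k * g (- of_real r)) + (1 - r) ^ k * C) \<longlongrightarrow> norm (0::complex) + (1 - 1) ^ k * C) (at_left (1::real))"
    by (intro tendsto_intros lim1)
  then have up: "((\<lambda>r. norm (of_real (1 - r) ^ k * g (- of_real r)) + (1 - r) ^ k * C) \<longlongrightarrow> 0) (at_left (1::real))"
    using k by (simp add: power_0_left)
  have "norm L \<le> 0"
  proof (rule tendsto_le[OF _ up tendsto_norm[OF lim2]])
    show "at_left (1::real) \<noteq> bot" by simp
    have "\<forall>\<^sub>F r in at_left (1::real). r \<in> {0<..<1}"
      by (rule eventually_at_left_real) simp
    then show "\<forall>\<^sub>F r in at_left (1::real). norm (of_real (1 - r) ^ k * g (\<zeta> * of_real r))
        \<le> norm (of_real (1 - r) ^ k * g (- of_real r)) + (1 - r) ^ k * C"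
    proof eventually_elim
      case (elim r)
      then have "(1 - r) ^ k * norm (g (\<zeta> * of_real r)) \<le> (1 - r) ^ k * (norm (g (- of_real r)) + C)"
        using bound[of r] by (intro mult_left_mono) auto
      moreover have "norm (of_real (1 - r) ^ k :: complex) = (1 - r) ^ k"
        using elim by (simp add: norm_power flip: of_real_diff)
      ultimately show ?case
        by (simp add: norm_mult distrib_left del: of_real_diff)
    qed
  qed
  then show False using L by simp
qed

section \<open>Rational functions without poles in the open unit disc\<close>

definition complex_poly :: "real poly \<Rightarrow> complex poly" where
  "complex_poly = map_poly of_real"

lemma coeff_complex_poly: "coeff (complex_poly p) i = of_real (coeff p i)"
  by (simp add: complex_poly_def coeff_map_poly)

lemma complex_poly_simps:
  "complex_poly (p + q) = complex_poly p + complex_poly q"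
  "complex_poly (- p) = - complex_poly p"
  "complex_poly (p * q) = complex_poly p * complex_poly q"
  "complex_poly 0 = 0" "complex_poly 1 = 1"
  by (rule poly_eqI; simp add: coeff_complex_poly coeff_mult)+

text \<open>The link between the formal fraction \<open>r\<close>, whose Taylor coefficients are in
  question, and the function \<open>g\<close>, whose boundary behaviour can be computed. The
  denominator must have no zero in the whole open disc, since convergence is needed up to radius
  1.\<close>

definition disc_rep :: "real poly fract \<Rightarrow> (complex \<Rightarrow> complex) \<Rightarrow> bool" where
  "disc_rep r g \<longleftrightarrow> (\<exists>a b. r = Fract a b \<and> (\<forall>z. norm z < 1 \<longrightarrow>
     poly (complex_poly b) z \<noteq> 0 \<and> g z = poly (complex_poly a) z / poly (complex_poly b) z))"

lemma disc_repE:
  assumes "disc_rep r g"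
  obtains a b where "r = Fract a b" "b \<noteq> 0" "\<And>z. norm z < 1 \<Longrightarrow> poly (complex_poly b) z \<noteq> 0"
    "\<And>z. norm z < 1 \<Longrightarrow> g z = poly (complex_poly a) z / poly (complex_poly b) z"
proof -
  obtain a b where ab: "r = Fract a b" "\<And>z. norm z < 1 \<Longrightarrow> poly (complex_poly b) z \<noteq> 0"
    "\<And>z. norm z < 1 \<Longrightarrow> g z = poly (complex_poly a) z / poly (complex_poly b) z"
    using assms unfolding disc_rep_def by blast
  have "b \<noteq> 0" using ab(2)[of 0] by (auto simp: complex_poly_simps)
  then show ?thesis using that ab by blast
qed

lemma disc_rep_1: "disc_rep 1 (\<lambda>_. 1)"
  unfolding disc_rep_def One_fract_def by (intro exI[of _ 1]) (simp add: complex_poly_simps)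

lemma disc_rep_q_var: "disc_rep q_var (\<lambda>z. z)"
  unfolding disc_rep_def q_var_def to_fract_def
  by (intro exI[of _ "[:0, 1:]"] exI[of _ 1]) (simp add: complex_poly_simps, simp add: complex_poly_def map_poly_pCons)

lemma disc_rep_add: "disc_rep r g \<Longrightarrow> disc_rep s h \<Longrightarrow> disc_rep (r + s) (\<lambda>z. g z + h z)"
  by (elim disc_repE, unfold disc_rep_def,
      rule_tac x = "a * ba + aa * b" in exI, rule_tac x = "b * ba" in exI)
    (simp add: complex_poly_simps add_frac_eq)

lemma disc_rep_minus: "disc_rep r g \<Longrightarrow> disc_rep (- r) (\<lambda>z. - g z)"
  by (elim disc_repE, unfold disc_rep_def, rule_tac x = "- a" in exI, rule_tac x = b in exI)
    (simp add: complex_poly_simps)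

lemma disc_rep_mult: "disc_rep r g \<Longrightarrow> disc_rep s h \<Longrightarrow> disc_rep (r * s) (\<lambda>z. g z * h z)"
  by (elim disc_repE, unfold disc_rep_def, rule_tac x = "a * aa" in exI, rule_tac x = "b * ba" in exI)
    (simp add: complex_poly_simps)

lemma disc_rep_divide:
  assumes "disc_rep r g" "disc_rep s h" "\<And>z. norm z < 1 \<Longrightarrow> h z \<noteq> 0"
  shows "disc_rep (r / s) (\<lambda>z. g z / h z)"
proof -
  obtain a b where ab: "r = Fract a b" "\<And>z. norm z < 1 \<Longrightarrow> poly (complex_poly b) z \<noteq> 0"
    "\<And>z. norm z < 1 \<Longrightarrow> g z = poly (complex_poly a) z / poly (complex_poly b) z"
    using assms(1) by (rule disc_repE) blast
  obtain c d where cd: "s = Fract c d" "\<And>z. norm z < 1 \<Longrightarrow> poly (complex_poly d) z \<noteq> 0"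
    "\<And>z. norm z < 1 \<Longrightarrow> h z = poly (complex_poly c) z / poly (complex_poly d) z"
    using assms(2) by (rule disc_repE) blast
  have "poly (complex_poly c) z \<noteq> 0" if "norm z < 1" for z
    using assms(3)[OF that] cd(3)[OF that] by auto
  then show ?thesis
    unfolding disc_rep_def using ab cd
    by (intro exI[of _ "a * d"] exI[of _ "b * c"]) (simp add: complex_poly_simps)
qed

lemma disc_rep_nonzero:
  assumes "disc_rep r g" "g 0 \<noteq> 0"
  shows "r \<noteq> 0"
proof -
  obtain a b where ab: "r = Fract a b" "b \<noteq> 0"
    and g: "\<And>z. norm z < 1 \<Longrightarrow> g z = poly (complex_poly a) z / poly (complex_poly b) z"
    using assms(1) by (rule disc_repE) blast
  have "a \<noteq> 0" using assms(2) g[of 0] by (auto simp: complex_poly_simps)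
  then show ?thesis using ab(1,2) by (simp add: Zero_fract_def eq_fract)
qed

text \<open>As power series, \<open>F\<close> is the numerator times the inverse of the denominator.
  A polynomial without zeros in the unit disc has an inverse series of convergence radius at least
  1.\<close>

lemma taylor_at_0_sums:
  assumes "disc_rep r g" and z: "norm z < 1"
  shows "(\<lambda>l. of_real (fps_nth (taylor_at_0 r) l) * z ^ l) sums g z"
proof -
  obtain a b where ab: "r = Fract a b" "b \<noteq> 0" "\<And>z. norm z < 1 \<Longrightarrow> poly (complex_poly b) z \<noteq> 0"
    "\<And>z. norm z < 1 \<Longrightarrow> g z = poly (complex_poly a) z / poly (complex_poly b) z"
    using assms(1) by (rule disc_repE) blast
  let ?A = "fps_of_poly (complex_poly a)" and ?B = "fps_of_poly (complex_poly b)"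
  define f where "f = taylor_at_0 r"
  define F where "F = Abs_fps (\<lambda>l. complex_of_real (fps_nth f l))"
  have "coeff (complex_poly b) 0 \<noteq> 0"
    using ab(3)[of 0] by (simp add: poly_0_coeff_0)
  then have b0: "poly b 0 \<noteq> 0" "fps_nth (fps_of_poly b) 0 \<noteq> 0" "fps_nth ?B 0 \<noteq> 0"
    by (simp_all add: poly_0_coeff_0 coeff_complex_poly)
  have "f = fps_of_poly a / fps_of_poly b"
    unfolding f_def ab(1) by (rule taylor_at_0_Fract[OF b0(1)])
  then have "f * fps_of_poly b = fps_of_poly a"
    using b0(2) by (simp add: fps_divide_unit mult.assoc inverse_mult_eq_1)
  then have "F * ?B = ?A"
  proof -
    assume eq: "f * fps_of_poly b = fps_of_poly a"
    have "fps_nth (F * ?B) n = fps_nth ?A n" for n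
    proof -
      have "fps_nth (F * ?B) n = of_real (fps_nth (f * fps_of_poly b) n)"
        by (simp add: fps_mult_nth F_def coeff_complex_poly)
      then show ?thesis by (simp add: eq coeff_complex_poly)
    qed
    then show ?thesis by (rule fps_ext)
  qed
  then have F: "F = ?A * inverse ?B"
    using b0(3) by (metis inverse_mult_eq_1' mult.assoc mult.right_neutral)
  have "min 1 (fps_conv_radius ?B) \<le> fps_conv_radius (inverse ?B)"
    by (rule fps_conv_radius_inverse) (use ab(3) in auto)
  then have rad: "fps_conv_radius (inverse ?B) \<ge> 1" by simp
  have radF: "fps_conv_radius F \<ge> 1"
    unfolding F by (rule order.trans[OF _ fps_conv_radius_mult]) (use rad in auto)
  have zr: "ereal (norm z) < 1" using z by simp
  have "eval_fps F z = g z"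
  proof -
    have "eval_fps F z = eval_fps ?A z * eval_fps (inverse ?B) z"
      unfolding F using less_le_trans[OF zr rad] by (intro eval_fps_mult) simp_all
    also have "eval_fps (inverse ?B) z = inverse (eval_fps ?B z)"
      using zr ab(3) by (intro eval_fps_inverse[where r = 1]) auto
    finally show ?thesis using ab(4)[OF z] by (simp add: field_simps)
  qed
  moreover have "summable (\<lambda>n. fps_nth F n * z ^ n)"
    using less_le_trans[OF zr radF] by (intro summable_fps) simp
  ultimately have "(\<lambda>n. fps_nth F n * z ^ n) sums g z"
    unfolding eval_fps_def by (auto dest: summable_sums)
  then show ?thesis by (simp add: F_def f_def)
qed

section \<open>The pole orders at $-1$ and $i$\<close>

text \<open>In \<open>mag1\<close> to \<open>mag4\<close> only the weights to which later triangles
  are glued remain variables. The first triangle is glued to the fourth line of the plane, and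
  \<open>x\<close> is the weight of the first line. That line carries the second triangle, whose new
  weights are \<open>y\<close> and \<open>z\<close> in \<open>mag2\<close>; the third is glued to
  \<open>y\<close> and the fourth to \<open>z\<close>.\<close>

definition mag1 :: "'a::field \<Rightarrow> 'a \<Rightarrow> 'a" where
  "mag1 q x = glue_coeff1 q q * pencil4_magnitude x q q q
            + glue_coeff2 q q * pencil4_magnitude x q q (- (q * q) * q)"

definition mag2 :: "'a::field \<Rightarrow> 'a \<Rightarrow> 'a \<Rightarrow> 'a" where
  "mag2 q y z = glue_coeff1 y z * mag1 q q + glue_coeff2 y z * mag1 q (- (y * z) * q)"

definition mag3 :: "'a::field \<Rightarrow> 'a \<Rightarrow> 'a" where
  "mag3 q z = glue_coeff1 q q * mag2 q q z + glue_coeff2 q q * mag2 q (- (q * q) * q) z"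

definition mag4 :: "'a::field \<Rightarrow> 'a" where
  "mag4 q = glue_coeff1 q q * mag3 q q + glue_coeff2 q q * mag3 q (- (q * q) * q)"

lemmas mag_defs = mag1_def mag2_def mag3_def mag4_def glue_coeff1_def glue_coeff2_def pencil4_magnitude_def

lemma of_real_mag4: "(of_real (mag4 x) :: complex) = mag4 (of_real x)"
  by (simp add: mag_defs)

section \<open>Pole order at -1\<close>

lemma bigo_pole_mono:
  fixes f :: "real \<Rightarrow> real"
  assumes "f \<in> O[at_left 1](\<lambda>r. (1 / (1 - r)) ^ a)" "a \<le> b"
  shows "f \<in> O[at_left 1](\<lambda>r. (1 / (1 - r)) ^ b)"
proof (rule landau_o.big.trans[OF assms(1)], rule bigoI[of _ 1])
  have "eventually (\<lambda>r::real. r \<in> {0<..<1}) (at_left 1)"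
    by (rule eventually_at_left_real) simp
  then show "\<forall>\<^sub>F r in at_left (1::real). norm ((1 / (1 - r)) ^ a) \<le> 1 * norm ((1 / (1 - r)) ^ b)"
  proof eventually_elim
    case (elim r)
    then have "1 \<le> 1 / (1 - r)" by simp
    then have "(1 / (1 - r)) ^ a \<le> (1 / (1 - r)) ^ b"
      using assms(2) by (rule power_increasing[rotated])
    then show ?case using elim by simp
  qed
qed

lemma bigo_pole_mult:
  fixes f g :: "real \<Rightarrow> real"
  assumes "f \<in> O[at_left 1](\<lambda>r. (1 / (1 - r)) ^ a)" "g \<in> O[at_left 1](\<lambda>r. (1 / (1 - r)) ^ b)"
    "a + b \<le> m"
  shows "(\<lambda>r. f r * g r) \<in> O[at_left 1](\<lambda>r. (1 / (1 - r)) ^ m)"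
proof (rule bigo_pole_mono[OF _ assms(3)])
  show "(\<lambda>r. f r * g r) \<in> O[at_left 1](\<lambda>r. (1 / (1 - r)) ^ (a + b))"
    unfolding power_add using assms(1,2) by (rule landau_o.big.mult)
qed

text \<open>Here \<open>1 + yz\<close> tends to 2. In the second coefficient the double zero of
  \<open>(1 + y) (1 + z)\<close> meets a simple zero of \<open>1 - yz\<close>.\<close>

lemma glue_coeff_bigo:
  "(\<lambda>r::real. glue_coeff1 (- r) (- r)) \<in> O[at_left 1](\<lambda>r. (1 / (1 - r)) ^ 0)"
  "(\<lambda>r::real. glue_coeff2 (- r) (- r)) \<in> O[at_left 1](\<lambda>r. (1 / (1 - r)) ^ 1)"
  unfolding glue_coeff1_def glue_coeff2_def by real_asymp+

text \<open>For \<open>q = - r\<close> the modified weight \<open>- q^3\<close> is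
  \<open>r ^ 3\<close>. The four pairs are those in the expansion of \<open>mag4\<close>. Each
  replacement of \<open>- r\<close> by \<open>r ^ 3\<close> lowers the bound by one, which pays for
  the simple pole of the second coefficient that accompanies it; this is why the bound 4 survives
  the last two steps.\<close>

lemma mag2_bigo:
  "(\<lambda>r::real. mag2 (- r) (- r) (- r)) \<in> O[at_left 1](\<lambda>r. (1 / (1 - r)) ^ 4)"
  "(\<lambda>r::real. mag2 (- r) (- r) (r ^ 3)) \<in> O[at_left 1](\<lambda>r. (1 / (1 - r)) ^ 3)"
  "(\<lambda>r::real. mag2 (- r) (r ^ 3) (- r)) \<in> O[at_left 1](\<lambda>r. (1 / (1 - r)) ^ 3)"
  "(\<lambda>r::real. mag2 (- r) (r ^ 3) (r ^ 3)) \<in> O[at_left 1](\<lambda>r. (1 / (1 - r)) ^ 2)"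
  unfolding mag2_def mag1_def glue_coeff1_def glue_coeff2_def pencil4_magnitude_def by real_asymp+

lemma mag4_at_minus_one: "((\<lambda>r::real. (1 - r) ^ 5 * mag4 (- r)) \<longlongrightarrow> 0) (at_left 1)"
proof -
  let ?A = "\<lambda>r::real. glue_coeff1 (- r) (- r)" and ?B = "\<lambda>r::real. glue_coeff2 (- r) (- r)"
  have "(\<lambda>r. mag4 (- r)) = (\<lambda>r. ?A r * (?A r * mag2 (- r) (- r) (- r) + ?B r * mag2 (- r) (r ^ 3) (- r))
      + ?B r * (?A r * mag2 (- r) (- r) (r ^ 3) + ?B r * mag2 (- r) (r ^ 3) (r ^ 3)))"
    by (simp add: mag4_def mag3_def power3_eq_cube)
  also have "\<dots> \<in> O[at_left 1](\<lambda>r. (1 / (1 - r)) ^ 4)"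
  proof (intro sum_in_bigo)
    have "(\<lambda>r. ?A r * mag2 (- r) (- r) (- r) + ?B r * mag2 (- r) (r ^ 3) (- r)) \<in> O[at_left 1](\<lambda>r. (1 / (1 - r)) ^ 4)"
      by (intro sum_in_bigo bigo_pole_mult[OF glue_coeff_bigo(1) mag2_bigo(1)]
            bigo_pole_mult[OF glue_coeff_bigo(2) mag2_bigo(3)]) simp_all
    then show "(\<lambda>r. ?A r * (?A r * mag2 (- r) (- r) (- r) + ?B r * mag2 (- r) (r ^ 3) (- r)))
        \<in> O[at_left 1](\<lambda>r. (1 / (1 - r)) ^ 4)"
      by (rule bigo_pole_mult[OF glue_coeff_bigo(1)]) simp
    have "(\<lambda>r. ?A r * mag2 (- r) (- r) (r ^ 3) + ?B r * mag2 (- r) (r ^ 3) (r ^ 3)) \<in> O[at_left 1](\<lambda>r. (1 / (1 - r)) ^ 3)"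
      by (intro sum_in_bigo bigo_pole_mult[OF glue_coeff_bigo(1) mag2_bigo(2)]
            bigo_pole_mult[OF glue_coeff_bigo(2) mag2_bigo(4)]) simp_all
    then show "(\<lambda>r. ?B r * (?A r * mag2 (- r) (- r) (r ^ 3) + ?B r * mag2 (- r) (r ^ 3) (r ^ 3)))
        \<in> O[at_left 1](\<lambda>r. (1 / (1 - r)) ^ 4)"
      by (rule bigo_pole_mult[OF glue_coeff_bigo(2)]) simp
  qed
  finally have "(\<lambda>r::real. (1 - r) ^ 5 * mag4 (- r)) \<in> O[at_left 1](\<lambda>r. (1 - r) ^ 5 * (1 / (1 - r)) ^ 4)"
    by (intro landau_o.big.mult landau_o.big_refl)
  also have "(\<lambda>r::real. (1 - r) ^ 5 * (1 / (1 - r)) ^ 4) \<in> o[at_left 1](\<lambda>_. 1)"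
    by real_asymp
  finally show ?thesis
    by (auto dest: smalloD_tendsto)
qed

section \<open>Leading terms at i\<close>

lemma tendsto_one_minus_power:
  assumes "n > 0"
  shows "((\<lambda>r::real. (1 - r) / (1 - r ^ n)) \<longlongrightarrow> 1 / real n) (at_left 1)"
proof (rule Lim_transform_eventually)
  have "((\<lambda>r::real. 1 / (\<Sum>i<n. r ^ i)) \<longlongrightarrow> 1 / (\<Sum>i<n. 1 ^ i)) (at_left 1)"
    using assms by (intro tendsto_intros) simp
  then show "((\<lambda>r::real. 1 / (\<Sum>i<n. r ^ i)) \<longlongrightarrow> 1 / real n) (at_left 1)"
    by simp
  have "eventually (\<lambda>r::real. r \<in> {0<..<1}) (at_left 1)"
    by (rule eventually_at_left_real) simp
  then show "\<forall>\<^sub>F r in at_left (1::real). 1 / (\<Sum>i<n. r ^ i) = (1 - r) / (1 - r ^ n)"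
    by eventually_elim (simp add: one_diff_power_eq)
qed

text \<open>
  For \<open>q = ir\<close> all weights that occur tend to \<open>i\<close>, and the denominators are of the form
  \<open>1 - r ^ (2 * m)\<close>.
\<close>

lemma glue_coeff_tendsto_i:
  fixes y z :: "real \<Rightarrow> complex"
  assumes y: "(y \<longlongrightarrow> \<i>) (at_left 1)" and z: "(z \<longlongrightarrow> \<i>) (at_left 1)"
    and yz: "\<And>r. y r * z r = - (of_real r ^ (2 * m))" and m: "m > 0"
  shows "((\<lambda>r. of_real (1 - r) * glue_coeff1 (y r) (z r)) \<longlongrightarrow> 1 / of_nat m) (at_left 1)"
    and "((\<lambda>r. of_real (1 - r) * glue_coeff2 (y r) (z r)) \<longlongrightarrow> - 1 / of_nat m) (at_left 1)"
proof -
  have "((\<lambda>r. (1 - r) / (1 - r ^ (2 * m))) \<longlongrightarrow> 1 / (2 * real m)) (at_left (1::real))"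
    using tendsto_one_minus_power[of "2 * m"] m by simp
  then have lim: "((\<lambda>r. of_real ((1 - r) / (1 - r ^ (2 * m)))) \<longlongrightarrow> (of_real (1 / (2 * real m)) :: complex)) (at_left 1)"
    by (rule tendsto_of_real)
  have eq: "of_real (1 - r) / (1 + y r * z r) = of_real ((1 - r) / (1 - r ^ (2 * m)))" for r
    by (simp add: yz)
  have "((\<lambda>r. 2 * (of_real (1 - r) / (1 + y r * z r))) \<longlongrightarrow> 2 * of_real (1 / (2 * real m))) (at_left 1)"
    unfolding eq by (intro tendsto_intros lim)
  then show "((\<lambda>r. of_real (1 - r) * glue_coeff1 (y r) (z r)) \<longlongrightarrow> 1 / of_nat m) (at_left 1)"
    using m by (simp add: glue_coeff1_def field_simps)
  have i1: "1 + \<i> \<noteq> 0" by (simp add: complex_eq_iff)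
  have "((\<lambda>r. (1 - y r) * (1 - z r) * (1 - y r * z r) / ((1 + y r) * (1 + z r)) * (of_real (1 - r) / (1 + y r * z r)))
     \<longlongrightarrow> (1 - \<i>) * (1 - \<i>) * (1 - \<i> * \<i>) / ((1 + \<i>) * (1 + \<i>)) * of_real (1 / (2 * real m))) (at_left 1)"
    unfolding eq using i1 by (intro tendsto_intros lim y z) simp
  \<comment> \<open>Since \<open>(1 - i) / (1 + i)\<close> has square -1 and \<open>1 - yz\<close>
    tends to 2, the second coefficient has the opposite limit of the first.\<close>
  moreover have "(1 - \<i>) * (1 - \<i>) * (1 - \<i> * \<i>) / ((1 + \<i>) * (1 + \<i>)) * of_real (1 / (2 * real m)) = - 1 / of_nat m"
  proof -
    have "(1 - \<i>) * (1 - \<i>) / ((1 + \<i>) * (1 + \<i>)) = - 1"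
      using i1 by (simp add: divide_simps) (simp add: algebra_simps)
    then have "(1 - \<i>) * (1 - \<i>) * (1 - \<i> * \<i>) / ((1 + \<i>) * (1 + \<i>)) = - 2"
      by (simp only: times_divide_eq_left [symmetric] i_squared) simp
    then show ?thesis using m by (simp only:) simp
  qed
  moreover have "(1 - y r) * (1 - z r) * (1 - y r * z r) / ((1 + y r) * (1 + z r)) * (of_real (1 - r) / (1 + y r * z r))
      = of_real (1 - r) * glue_coeff2 (y r) (z r)" for r
    by (simp add: glue_coeff2_def mult_ac)
  ultimately show "((\<lambda>r. of_real (1 - r) * glue_coeff2 (y r) (z r)) \<longlongrightarrow> - 1 / of_nat m) (at_left 1)"
    by simp
qed


text \<open>Only \<open>1 - abcd\<close> degenerates at \<open>i\<close>; each of the four quotients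
  tends to \<open>- i\<close>. The exponent \<open>2 * m\<close> is kept because the value of the
  limit depends on how fast the product tends to 1.\<close>

lemma pencil4_tendsto_i:
  fixes a b c d :: "real \<Rightarrow> complex"
  assumes a: "(a \<longlongrightarrow> \<i>) (at_left 1)" and b: "(b \<longlongrightarrow> \<i>) (at_left 1)"
    and c: "(c \<longlongrightarrow> \<i>) (at_left 1)" and d: "(d \<longlongrightarrow> \<i>) (at_left 1)"
    and abcd: "\<And>r. a r * b r * c r * d r = of_real r ^ (2 * m)" and m: "m > 0"
  shows "((\<lambda>r. of_real (1 - r) * pencil4_magnitude (a r) (b r) (c r) (d r))
           \<longlongrightarrow> - 4 * \<i> / of_nat m) (at_left 1)"
proof -
  have "((\<lambda>r. (1 - r) / (1 - r ^ (2 * m))) \<longlongrightarrow> 1 / (2 * real m)) (at_left (1::real))"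
    using tendsto_one_minus_power[of "2 * m"] m by simp
  then have lim: "((\<lambda>r. of_real ((1 - r) / (1 - r ^ (2 * m)))) \<longlongrightarrow> (of_real (1 / (2 * real m)) :: complex)) (at_left 1)"
    by (rule tendsto_of_real)
  have eq: "of_real (1 - r) / (1 - a r * b r * c r * d r) = of_real ((1 - r) / (1 - r ^ (2 * m)))" for r
    by (simp add: abcd)
  have i1: "1 + \<i> \<noteq> 0" by (simp add: complex_eq_iff)
  have h: "(1 - \<i>) / (1 + \<i>) = - \<i>"
    using i1 by (simp add: divide_simps) (simp add: algebra_simps)
  have lim': "((\<lambda>r. 2 * (of_real (1 - r) / (1 - a r * b r * c r * d r)) *
      ((1 - a r) / (1 + a r) + (1 - b r) / (1 + b r) + (1 - c r) / (1 + c r) + (1 - d r) / (1 + d r)))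
     \<longlongrightarrow> 2 * of_real (1 / (2 * real m)) * ((1 - \<i>) / (1 + \<i>) + (1 - \<i>) / (1 + \<i>) + (1 - \<i>) / (1 + \<i>) + (1 - \<i>) / (1 + \<i>))) (at_left 1)"
    unfolding eq using i1 by (intro tendsto_intros lim a b c d) simp_all
  have val: "2 * of_real (1 / (2 * real m)) * ((1 - \<i>) / (1 + \<i>) + (1 - \<i>) / (1 + \<i>) + (1 - \<i>) / (1 + \<i>) + (1 - \<i>) / (1 + \<i>))
      = - 4 * \<i> / of_nat m"
    unfolding h using m by simp
  have assoc: "2 * (x / y) * s = x * (2 / y * s)" for x y s :: complex
    by simp
  show ?thesis
    unfolding pencil4_magnitude_def by (rule lim'[unfolded val assoc])
qed


text \<open>Gluing moves the product of the four weights from exponent \<open>2 * (m + 1)\<close> to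
  \<open>2 * (m + 2)\<close>. The two coefficients tend to 1 and -1, so the limit is a difference of
  the values \<open>- 4 i / m\<close> at neighbouring integers and does not cancel.\<close>

lemma mag1_tendsto_i:
  fixes q x :: "real \<Rightarrow> complex"
  assumes q: "(q \<longlongrightarrow> \<i>) (at_left 1)" and x: "(x \<longlongrightarrow> \<i>) (at_left 1)"
    and qq: "\<And>r. q r * q r = - (of_real r ^ 2)"
    and xq: "\<And>r. x r * q r = - (of_real r ^ (2 * m))" and m: "m > 0"
  shows "((\<lambda>r. of_real (1 - r) ^ 2 * mag1 (q r) (x r))
           \<longlongrightarrow> - 4 * \<i> / of_nat (m + 1) + 4 * \<i> / of_nat (m + 2)) (at_left 1)"
proof -
  have "((\<lambda>r. - (q r * q r) * q r) \<longlongrightarrow> - (\<i> * \<i>) * \<i>) (at_left 1)"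
    by (intro tendsto_intros q)
  then have q3: "((\<lambda>r. - (q r * q r) * q r) \<longlongrightarrow> \<i>) (at_left 1)" by simp
  have "((\<lambda>r. (of_real (1 - r) * glue_coeff1 (q r) (q r)) * (of_real (1 - r) * pencil4_magnitude (x r) (q r) (q r) (q r))
      + (of_real (1 - r) * glue_coeff2 (q r) (q r)) * (of_real (1 - r) * pencil4_magnitude (x r) (q r) (q r) (- (q r * q r) * q r)))
     \<longlongrightarrow> 1 / of_nat 1 * (- 4 * \<i> / of_nat (m + 1)) + - 1 / of_nat 1 * (- 4 * \<i> / of_nat (m + 2))) (at_left 1)"
  proof (intro tendsto_intros glue_coeff_tendsto_i pencil4_tendsto_i q x q3)
    fix r
    have "x r * q r * q r * q r = (x r * q r) * (q r * q r)" by (simp add: mult_ac)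
    then show "x r * q r * q r * q r = of_real r ^ (2 * (m + 1))"
      unfolding xq qq by (simp add: power2_eq_square mult_ac)
    have "x r * q r * q r * (- (q r * q r) * q r) = - ((x r * q r) * (q r * q r) * (q r * q r))"
      by (simp add: mult_ac)
    then show "x r * q r * q r * (- (q r * q r) * q r) = of_real r ^ (2 * (m + 2))"
      unfolding xq qq by (simp add: power_add power2_eq_square mult_ac)
  qed (simp_all add: qq)
  then show ?thesis
    by (simp add: mag1_def power2_eq_square algebra_simps)
qed

text \<open>The second triangle replaces the weight \<open>q\<close> of the first line by
  \<open>- (y z) q\<close>, which shifts the parameter of \<open>mag1_tendsto_i\<close> from 1 to
  \<open>m + 1\<close>.\<close>

lemma mag2_tendsto_i:
  fixes q y z :: "real \<Rightarrow> complex"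
  assumes q: "(q \<longlongrightarrow> \<i>) (at_left 1)"
    and y: "(y \<longlongrightarrow> \<i>) (at_left 1)" and z: "(z \<longlongrightarrow> \<i>) (at_left 1)"
    and qq: "\<And>r. q r * q r = - (of_real r ^ 2)"
    and yz: "\<And>r. y r * z r = - (of_real r ^ (2 * m))" and m: "m > 0"
  shows "((\<lambda>r. of_real (1 - r) ^ 3 * mag2 (q r) (y r) (z r))
           \<longlongrightarrow> (1 / of_nat m * (- 4 * \<i> / of_nat (1 + 1) + 4 * \<i> / of_nat (1 + 2))
       + - 1 / of_nat m * (- 4 * \<i> / of_nat (m + 1 + 1) + 4 * \<i> / of_nat (m + 1 + 2)))) (at_left 1)"
proof -
  have "((\<lambda>r. - (y r * z r) * q r) \<longlongrightarrow> - (\<i> * \<i>) * \<i>) (at_left 1)"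
    by (intro tendsto_intros q y z)
  then have e: "((\<lambda>r. - (y r * z r) * q r) \<longlongrightarrow> \<i>) (at_left 1)" by simp
  have m1: "((\<lambda>r. of_real (1 - r) ^ 2 * mag1 (q r) (q r)) \<longlongrightarrow> - 4 * \<i> / of_nat (1 + 1) + 4 * \<i> / of_nat (1 + 2)) (at_left 1)"
    by (rule mag1_tendsto_i[OF q q qq]) (simp_all add: qq)
  have "- (y r * z r) * q r * q r = - (of_real r ^ (2 * (m + 1)))" for r
  proof -
    have "- (y r * z r) * q r * q r = - ((y r * z r) * (q r * q r))" by (simp add: mult_ac)
    then show ?thesis unfolding yz qq by (simp add: power2_eq_square mult_ac)
  qed
  then have m2: "((\<lambda>r. of_real (1 - r) ^ 2 * mag1 (q r) (- (y r * z r) * q r)) \<longlongrightarrow>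
      - 4 * \<i> / of_nat (m + 1 + 1) + 4 * \<i> / of_nat (m + 1 + 2)) (at_left 1)"
    by (intro mag1_tendsto_i q e qq) simp_all
  have "((\<lambda>r. (of_real (1 - r) * glue_coeff1 (y r) (z r)) * (of_real (1 - r) ^ 2 * mag1 (q r) (q r))
      + (of_real (1 - r) * glue_coeff2 (y r) (z r)) * (of_real (1 - r) ^ 2 * mag1 (q r) (- (y r * z r) * q r)))
     \<longlongrightarrow> 1 / of_nat m * (- 4 * \<i> / of_nat (1 + 1) + 4 * \<i> / of_nat (1 + 2))
       + - 1 / of_nat m * (- 4 * \<i> / of_nat (m + 1 + 1) + 4 * \<i> / of_nat (m + 1 + 2))) (at_left 1)"
    by (intro tendsto_intros glue_coeff_tendsto_i[OF y z yz m] m1 m2)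
  also have "(\<lambda>r. (of_real (1 - r) * glue_coeff1 (y r) (z r)) * (of_real (1 - r) ^ 2 * mag1 (q r) (q r))
      + (of_real (1 - r) * glue_coeff2 (y r) (z r)) * (of_real (1 - r) ^ 2 * mag1 (q r) (- (y r * z r) * q r)))
      = (\<lambda>r. of_real (1 - r) ^ 3 * mag2 (q r) (y r) (z r))"
    unfolding mag2_def power3_eq_cube power2_eq_square by (intro ext) (simp only: distrib_left mult_ac)
  finally show ?thesis .
qed

lemma mag4_tendsto_i:
  "((\<lambda>r. of_real (1 - r) ^ 5 * mag4 (\<i> * of_real r)) \<longlongrightarrow> - 2 * \<i> / 45) (at_left 1)"
proof -
  define q where "q = (\<lambda>r. \<i> * complex_of_real r)"
  define p where "p = (\<lambda>r. - (q r * q r) * q r)"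
  have "(q \<longlongrightarrow> \<i> * of_real 1) (at_left 1)"
    unfolding q_def by (intro tendsto_intros)
  then have q: "(q \<longlongrightarrow> \<i>) (at_left 1)" by simp
  have "(p \<longlongrightarrow> - (\<i> * \<i>) * \<i>) (at_left 1)"
    unfolding p_def by (intro tendsto_intros q)
  then have p: "(p \<longlongrightarrow> \<i>) (at_left 1)" by simp
  have qq: "q r * q r = - (of_real r ^ 2)" for r
  proof -
    have "q r * q r = (\<i> * \<i>) * (of_real r * of_real r)"
      unfolding q_def by (simp only: mult_ac)
    then show ?thesis by (simp add: power2_eq_square)
  qed
  have prods: "q r * q r = - (of_real r ^ (2 * 1))" "q r * p r = - (of_real r ^ (2 * 2))"
    "p r * q r = - (of_real r ^ (2 * 2))" "p r * p r = - (of_real r ^ (2 * 3))" for r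
  proof -
    have "q r * p r = - ((q r * q r) * (q r * q r))" "p r * q r = - ((q r * q r) * (q r * q r))"
      "p r * p r = (q r * q r) * (q r * q r) * (q r * q r)"
      unfolding p_def by (simp_all add: mult_ac)
    then show "q r * q r = - (of_real r ^ (2 * 1))" "q r * p r = - (of_real r ^ (2 * 2))"
      "p r * q r = - (of_real r ^ (2 * 2))" "p r * p r = - (of_real r ^ (2 * 3))"
      unfolding qq by (simp_all add: eval_nat_numeral mult_ac)
  qed
  note A = glue_coeff_tendsto_i[OF q q prods(1), simplified]
  note M = mag2_tendsto_i[OF q q q qq prods(1)] mag2_tendsto_i[OF q q p qq prods(2)]
    mag2_tendsto_i[OF q p q qq prods(3)] mag2_tendsto_i[OF q p p qq prods(4)]
  \<comment> \<open>The pairs in \<open>M\<close> have parameters 1, 2, 2, 3, and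
    \<open>mag2_tendsto_i\<close> gives \<open>- i / 3\<close>, \<open>- 7 i / 30\<close> twice, and
    \<open>- 8 i / 45\<close>. With coefficients of limits 1 and -1 they combine to
    \<open>- 2 i / 45\<close>, which is not zero: the order 5 is attained.\<close>
  have "((\<lambda>r. (of_real (1 - r) * glue_coeff1 (q r) (q r)) *
       ((of_real (1 - r) * glue_coeff1 (q r) (q r)) * (of_real (1 - r) ^ 3 * mag2 (q r) (q r) (q r))
        + (of_real (1 - r) * glue_coeff2 (q r) (q r)) * (of_real (1 - r) ^ 3 * mag2 (q r) (p r) (q r)))
     + (of_real (1 - r) * glue_coeff2 (q r) (q r)) *
       ((of_real (1 - r) * glue_coeff1 (q r) (q r)) * (of_real (1 - r) ^ 3 * mag2 (q r) (q r) (p r))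
        + (of_real (1 - r) * glue_coeff2 (q r) (q r)) * (of_real (1 - r) ^ 3 * mag2 (q r) (p r) (p r))))
     \<longlongrightarrow> 1 * (1 * - (\<i> / 3) + - 1 * - (7 * \<i> / 30)) + - 1 * (1 * - (7 * \<i> / 30) + - 1 * - (8 * \<i> / 45))) (at_left 1)"
    using A M by (intro tendsto_intros) simp_all
  also have "(\<lambda>r. (of_real (1 - r) * glue_coeff1 (q r) (q r)) *
       ((of_real (1 - r) * glue_coeff1 (q r) (q r)) * (of_real (1 - r) ^ 3 * mag2 (q r) (q r) (q r))
        + (of_real (1 - r) * glue_coeff2 (q r) (q r)) * (of_real (1 - r) ^ 3 * mag2 (q r) (p r) (q r)))
     + (of_real (1 - r) * glue_coeff2 (q r) (q r)) *
       ((of_real (1 - r) * glue_coeff1 (q r) (q r)) * (of_real (1 - r) ^ 3 * mag2 (q r) (q r) (p r))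
        + (of_real (1 - r) * glue_coeff2 (q r) (q r)) * (of_real (1 - r) ^ 3 * mag2 (q r) (p r) (p r))))
     = (\<lambda>r. of_real (1 - r) ^ 5 * mag4 (q r))"
  proof
    fix r
    have scale: "(e * a) * ((e * a) * (e ^ 3 * x) + (e * b) * (e ^ 3 * y)) + (e * b) * ((e * a) * (e ^ 3 * z) + (e * b) * (e ^ 3 * t))
        = e ^ 5 * (a * (a * x + b * y) + b * (a * z + b * t))" for e a b x y z t :: complex
      by (simp add: eval_nat_numeral algebra_simps)
    show "(of_real (1 - r) * glue_coeff1 (q r) (q r)) *
       ((of_real (1 - r) * glue_coeff1 (q r) (q r)) * (of_real (1 - r) ^ 3 * mag2 (q r) (q r) (q r))
        + (of_real (1 - r) * glue_coeff2 (q r) (q r)) * (of_real (1 - r) ^ 3 * mag2 (q r) (p r) (q r)))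
     + (of_real (1 - r) * glue_coeff2 (q r) (q r)) *
       ((of_real (1 - r) * glue_coeff1 (q r) (q r)) * (of_real (1 - r) ^ 3 * mag2 (q r) (q r) (p r))
        + (of_real (1 - r) * glue_coeff2 (q r) (q r)) * (of_real (1 - r) ^ 3 * mag2 (q r) (p r) (p r)))
     = of_real (1 - r) ^ 5 * mag4 (q r)"
      unfolding scale mag4_def mag3_def p_def ..
  qed
  finally show ?thesis by (simp add: q_def)
qed

section \<open>The counterexample\<close>

text \<open>This class contains \<open>q\<close> and is closed under products and signs, so it
  contains every weight in the recursion. All denominators have factors of the form
  \<open>1 + r\<close> or \<open>1 - r\<close> with \<open>r\<close> in the class, which have no
  zero in the disc.\<close>

definition disc_small :: "real poly fract \<Rightarrow> (complex \<Rightarrow> complex) \<Rightarrow> bool" where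
  "disc_small r g \<longleftrightarrow> disc_rep r g \<and> (\<forall>z. norm z < 1 \<longrightarrow> norm (g z) < 1)"

lemma disc_small_q_var: "disc_small q_var (\<lambda>z. z)"
  by (simp add: disc_small_def disc_rep_q_var)

lemma disc_small_minus: "disc_small r g \<Longrightarrow> disc_small (- r) (\<lambda>z. - g z)"
  by (simp add: disc_small_def disc_rep_minus)

lemma disc_small_mult:
  assumes "disc_small r g" "disc_small s h"
  shows "disc_small (r * s) (\<lambda>z. g z * h z)"
proof -
  have "norm (g z * h z) < 1" if "norm z < 1" for z
    using assms that mult_strict_mono'[of "norm (g z)" 1 "norm (h z)" 1]
    by (simp add: disc_small_def norm_mult)
  then show ?thesis
    using assms by (simp add: disc_small_def disc_rep_mult)
qed

lemma disc_small_one_plus: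
  assumes "disc_small r g"
  shows "disc_rep (1 + r) (\<lambda>z. 1 + g z)" and "norm z < 1 \<Longrightarrow> 1 + g z \<noteq> 0" and "1 + r \<noteq> 0"
proof -
  show rep: "disc_rep (1 + r) (\<lambda>z. 1 + g z)"
    using assms disc_rep_add[OF disc_rep_1] by (simp add: disc_small_def)
  have nz: "1 + g z \<noteq> 0" if "norm z < 1" for z
  proof
    assume "1 + g z = 0"
    then have "g z = - 1" by (simp add: add_eq_0_iff)
    moreover have "norm (g z) < 1" using assms that by (simp add: disc_small_def)
    ultimately show False by simp
  qed
  then show "norm z < 1 \<Longrightarrow> 1 + g z \<noteq> 0" .
  show "1 + r \<noteq> 0"
    by (rule disc_rep_nonzero[OF rep]) (rule nz, simp)
qed

lemma disc_small_one_minus: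
  assumes "disc_small r g"
  shows "disc_rep (1 - r) (\<lambda>z. 1 - g z)" and "norm z < 1 \<Longrightarrow> 1 - g z \<noteq> 0" and "1 - r \<noteq> 0"
  using disc_small_one_plus[OF disc_small_minus[OF assms]] by simp_all

lemma disc_rep_2: "disc_rep 2 (\<lambda>_. 2)"
  using disc_rep_add[OF disc_rep_1 disc_rep_1] by simp

lemma disc_rep_glue_coeff:
  assumes "disc_small y g" "disc_small z h"
  shows "disc_rep (glue_coeff1 y z) (\<lambda>t. glue_coeff1 (g t) (h t))"
    and "disc_rep (glue_coeff2 y z) (\<lambda>t. glue_coeff2 (g t) (h t))"
proof -
  note yz = disc_small_mult[OF assms]
  note P = disc_small_one_plus(1)[OF yz] disc_small_one_plus(1)[OF assms(1)] disc_small_one_plus(1)[OF assms(2)]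
  note M = disc_small_one_minus(1)[OF assms(1)] disc_small_one_minus(1)[OF assms(2)] disc_small_one_minus(1)[OF yz]
  note nz = disc_small_one_plus(2)[OF yz] disc_small_one_plus(2)[OF assms(1)] disc_small_one_plus(2)[OF assms(2)]
  show "disc_rep (glue_coeff1 y z) (\<lambda>t. glue_coeff1 (g t) (h t))"
    unfolding glue_coeff1_def using nz(1) by (rule disc_rep_divide[OF disc_rep_2 P(1)])
  show "disc_rep (glue_coeff2 y z) (\<lambda>t. glue_coeff2 (g t) (h t))"
    unfolding glue_coeff2_def
    by (rule disc_rep_divide[OF disc_rep_mult[OF disc_rep_mult[OF M(1,2)] M(3)]
            disc_rep_mult[OF disc_rep_mult[OF P(1,2)] P(3)]]) (use nz in simp)
qed

lemma disc_rep_pencil4_magnitude: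
  assumes "disc_small a e" "disc_small b f" "disc_small c g" "disc_small d h"
  shows "disc_rep (pencil4_magnitude a b c d) (\<lambda>t. pencil4_magnitude (e t) (f t) (g t) (h t))"
proof -
  note abcd = disc_small_mult[OF disc_small_mult[OF disc_small_mult[OF assms(1,2)] assms(3)] assms(4)]
  have quot: "disc_rep ((1 - r) / (1 + r)) (\<lambda>t. (1 - k t) / (1 + k t))" if k: "disc_small r k" for r k
    using disc_small_one_plus(2)[OF k]
    by (rule disc_rep_divide[OF disc_small_one_minus(1)[OF k] disc_small_one_plus(1)[OF k]])
  have "disc_rep (2 / (1 - a * b * c * d)) (\<lambda>t. 2 / (1 - e t * f t * g t * h t))"
    using disc_small_one_minus(2)[OF abcd] by (rule disc_rep_divide[OF disc_rep_2 disc_small_one_minus(1)[OF abcd]])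
  then show ?thesis
    unfolding pencil4_magnitude_def by (intro disc_rep_mult disc_rep_add quot assms)
qed

lemma disc_rep_mag1:
  assumes "disc_small q g" "disc_small x h"
  shows "disc_rep (mag1 q x) (\<lambda>t. mag1 (g t) (h t))"
  unfolding mag1_def
  by (intro disc_rep_add disc_rep_mult disc_rep_glue_coeff disc_rep_pencil4_magnitude
        disc_small_mult disc_small_minus assms)

lemma disc_rep_mag2:
  assumes "disc_small q g" "disc_small y f" "disc_small z h"
  shows "disc_rep (mag2 q y z) (\<lambda>t. mag2 (g t) (f t) (h t))"
  unfolding mag2_def
  by (intro disc_rep_add disc_rep_mult disc_rep_glue_coeff disc_rep_mag1
        disc_small_mult disc_small_minus assms)

lemma disc_rep_mag4: "disc_rep (mag4 q_var) mag4"
proof -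
  have "disc_rep (mag4 q_var) (\<lambda>z. mag4 z)"
    unfolding mag4_def mag3_def
    by (intro disc_rep_add disc_rep_mult disc_rep_glue_coeff disc_rep_mag2
          disc_small_mult disc_small_minus disc_small_q_var)
  then show ?thesis by simp
qed

text \<open>Each step puts two forms in front of the list. So index 2 in the second step is the
  first line of the plane, index 0 in the third is the first form added by the second step, and
  index 3 in the fourth is the other form added there.\<close>

definition counterexample_forms :: "(nat \<Rightarrow> real) list" where
  "counterexample_forms =
    glue_forms 5 3 (glue_forms 4 0 (glue_forms 3 2 (glue_forms 2 3 pencil4_forms)))"

definition counterexample_topes :: "bool list set" where
  "counterexample_topes =
    glue_triangle 3 (glue_triangle 0 (glue_triangle 2 (glue_triangle 3 pencil4)))"

lemma realizes_counterexample: "realizes 6 counterexample_forms counterexample_topes"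
proof -
  have len: "length (glue_forms n j as) = Suc (Suc (length as))" "length pencil4_forms = 4" for n j as
    by (simp_all add: glue_forms_def pencil4_forms_def)
  have "realizes 3 (glue_forms 2 3 pencil4_forms) (glue_triangle 3 pencil4)"
    using realizes_glue_forms[OF realizes_pencil4, of 3] by (simp add: len)
  note this = realizes_glue_forms[OF this, of 2, simplified len, simplified]
  note this = realizes_glue_forms[OF this, of 0, simplified len, simplified]
  from realizes_glue_forms[OF this, of 3, simplified len, simplified]
  show ?thesis
    unfolding counterexample_forms_def counterexample_topes_def .
qed

lemma has_magnitude_counterexample:
  "has_magnitude (replicate 12 q_var) counterexample_topes (mag4 q_var)"
proof -
  \<comment> \<open>Membership in \<open>U\<close> supplies all nonvanishing hypotheses of the
    gluing lemma, now in the field of rational functions.\<close>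
  define U where "U = (\<lambda>r. \<exists>g. disc_small r g)"
  have U_minus: "U (- r)" if "U r" for r
    using that disc_small_minus unfolding U_def by blast
  have U_mult: "U (r * s)" if "U r" "U s" for r s
    using that disc_small_mult unfolding U_def by blast
  have U_nz: "1 + r \<noteq> 0" "1 - r \<noteq> 0" if "U r" for r
    using that disc_small_one_plus(3) disc_small_one_minus(3) unfolding U_def by blast+
  define q where "q = q_var"
  have q: "U q"
    unfolding U_def q_def using disc_small_q_var by blast
  let ?T1 = "glue_triangle 3 pencil4"
  let ?T2 = "glue_triangle 2 ?T1"
  let ?T3 = "glue_triangle 0 ?T2"
  have len1: "length s = 6" if "s \<in> ?T1" for s
    using length_glue_triangle[OF _ that, of 4] length_pencil4 by simp
  have len2: "length s = 8" if "s \<in> ?T2" for s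
    using length_glue_triangle[OF _ that, of 6] len1 by simp
  have len3: "length s = 10" if "s \<in> ?T3" for s
    using length_glue_triangle[OF _ that, of 8] len2 by simp
  note fin = finite_pencil4 finite_glue_triangle
  \<comment> \<open>Only the lines that carry a triangle need a free weight, and only until that
    triangle is glued: \<open>d\<close> is used up in \<open>m1\<close>, \<open>x\<close> in
    \<open>m2\<close>, \<open>y\<close> in \<open>m3\<close> and \<open>z\<close> in the last
    step.\<close>
  have m0: "has_magnitude [x, q, q, d] pencil4 (pencil4_magnitude x q q d)" if "U x" "U d" for x d
    using that q by (intro has_magnitude_pencil4 U_nz U_mult)
  have m1: "has_magnitude [q, q, x, q, q, q] ?T1 (mag1 q x)" if x: "U x" for x
    unfolding mag1_def
  proof (rule has_magnitude_glue_triangle)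
    show "has_magnitude [x, q, q, q] pencil4 (pencil4_magnitude x q q q)"
      by (rule m0[OF x q])
    show "has_magnitude ([x, q, q, q][3 := - (q * q) * [x, q, q, q] ! 3]) pencil4
        (pencil4_magnitude x q q (- (q * q) * q))"
      using m0[OF x, of "- (q * q) * q"] q by (simp add: U_mult U_minus numeral_3_eq_3)
  qed (use q fin length_pencil4 in \<open>simp_all add: U_nz U_mult\<close>)
  have m2: "has_magnitude [y, z, q, q, q, q, q, q] ?T2 (mag2 q y z)" if y: "U y" and z: "U z" for y z
    unfolding mag2_def
  proof (rule has_magnitude_glue_triangle)
    show "has_magnitude [q, q, q, q, q, q] ?T1 (mag1 q q)"
      by (rule m1[OF q])
    show "has_magnitude ([q, q, q, q, q, q][2 := - (y * z) * [q, q, q, q, q, q] ! 2]) ?T1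
        (mag1 q (- (y * z) * q))"
      using m1[of "- (y * z) * q"] q y z by (simp add: U_mult U_minus numeral_2_eq_2)
  qed (use q y z fin len1 in \<open>simp_all add: U_nz U_mult\<close>)
  have m3: "has_magnitude [q, q, q, z, q, q, q, q, q, q] ?T3 (mag3 q z)" if z: "U z" for z
    unfolding mag3_def
  proof (rule has_magnitude_glue_triangle)
    show "has_magnitude [q, z, q, q, q, q, q, q] ?T2 (mag2 q q z)"
      by (rule m2[OF q z])
    show "has_magnitude ([q, z, q, q, q, q, q, q][0 := - (q * q) * [q, z, q, q, q, q, q, q] ! 0]) ?T2
        (mag2 q (- (q * q) * q) z)"
      using m2[of "- (q * q) * q" z] q z by (simp add: U_mult U_minus)
  qed (use q fin len2 in \<open>simp_all add: U_nz U_mult\<close>)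
  have "has_magnitude [q, q, q, q, q, q, q, q, q, q, q, q] counterexample_topes (mag4 q)"
    unfolding mag4_def counterexample_topes_def
  proof (rule has_magnitude_glue_triangle)
    show "has_magnitude [q, q, q, q, q, q, q, q, q, q] ?T3 (mag3 q q)"
      by (rule m3[OF q])
    show "has_magnitude ([q, q, q, q, q, q, q, q, q, q][3 := - (q * q) * [q, q, q, q, q, q, q, q, q, q] ! 3]) ?T3
        (mag3 q (- (q * q) * q))"
      using m3[of "- (q * q) * q"] q by (simp add: U_mult U_minus numeral_3_eq_3)
  qed (use q fin len3 in \<open>simp_all add: U_nz U_mult\<close>)
  then show ?thesis
    by (simp add: q_def eval_nat_numeral)
qed

theorem corollary5p6:
  shows "(\<exists>n \<A>. central_arrangement n \<A> \<and>
             \<not> (\<forall>\<^sub>F l in sequentially. (-1) ^ l * mag_coeff n \<A> l \<ge> 0))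
         \<and> \<not> (\<forall>n \<A>. central_arrangement n \<A> \<longrightarrow>
                 (\<forall>\<^sub>F l in sequentially. (-1) ^ l * mag_coeff n \<A> l \<ge> 0))"
proof -
  let ?A = "hyperplane 6 ` set counterexample_forms"
  have R: "\<forall>a\<in>set counterexample_forms. \<exists>i<6. a i \<noteq> 0"
    "distinct (map (hyperplane 6) counterexample_forms)"
    "topes 6 counterexample_forms = counterexample_topes"
    using realizes_counterexample unfolding realizes_def by blast+
  have "length counterexample_forms = 12"
    by (simp add: counterexample_forms_def glue_forms_def pencil4_forms_def)
  then have mag: "magnitude 6 ?A = mag4 q_var"
    using magnitude_eq_has_magnitude[OF R(2), of "mag4 q_var"] has_magnitude_counterexample
    by (simp add: R(3))
  have central: "central_arrangement 6 ?A"
    unfolding central_arrangement_def using R(1) by blast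
  have "\<not> (\<forall>\<^sub>F l in sequentially. (-1) ^ l * mag_coeff 6 ?A l \<ge> 0)"
  proof (rule not_eventually_alternating[where g = mag4 and k = 5 and \<zeta> = \<i>])
    show "(\<lambda>l. of_real (mag_coeff 6 ?A l) * z ^ l) sums mag4 z" if "norm z < 1" for z :: complex
      unfolding mag_coeff_def mag by (rule taylor_at_0_sums[OF disc_rep_mag4 that])
    have "((\<lambda>r. of_real ((1 - r) ^ 5 * mag4 (- r)) :: complex) \<longlongrightarrow> of_real 0) (at_left (1::real))"
      by (rule tendsto_of_real[OF mag4_at_minus_one])
    then show "((\<lambda>r. of_real (1 - r) ^ 5 * mag4 (- of_real r :: complex)) \<longlongrightarrow> 0) (at_left (1::real))"
      by (simp add: of_real_mag4)
    show "((\<lambda>r. of_real (1 - r) ^ 5 * mag4 (\<i> * of_real r)) \<longlongrightarrow> - 2 * \<i> / 45) (at_left (1::real))"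
      by (rule mag4_tendsto_i)
  qed simp_all
  then show ?thesis
    using central by blast
qed

end
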